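(* Let $k$ be a nonnegative integer. Then for every integer $n\ge 0$, $$\sum_{|\lambda|=n}\frac{2^{|\lambda|-\ell(\lambda)}f_{\lambda}}{H_{\lambda}}\sum_{\square\in\lambda}\binom{c_{\square}+k-1}{2k}=\frac{2^k}{(k+1)!}\binom{n}{k+1},$$ where the outer sum ranges over all strict partitions $\lambda$ of size $n$.
   Context: A strict partition is a finite strictly decreasing sequence of positive integers $\lambda=(\lambda_1>\lambda_2>\cdots>\lambda_\ell)$ (the empty sequence is allowed); $|\lambda|=\sum_i\lambda_i$ is its size, $\ell(\lambda)=\ell$ its length, and $\lambda_i=0$ for $i>\ell(\lambda)$. The (shifted Young) diagram of $\lambda$ is the set of boxes $(i,j)$ with $1\le i\le \ell(\lambda)$ and $i+1\le j\le i+\lambda_i$ (row $i$, column $j$); $\lambda$ is identified with its diagram. The content of a box $\square=(i,j)$ is $c_\square=j-i$. The hook length $h_\square$ of $\square=(i,j)\in\lambda$ is the number of boxes of $\lambda$ in row $i$ strictly to the right of $\square$, plus the number of boxes $(i',j)\in\lambda$ with $i'>i$, plus $1$, plus $\lambda_j$. $H_\lambda=\prod_{\square\in\lambda}h_\square$. $f_\lambda$ is the number of standard shifted Young tableaux of shape $\lambda$, i.e. bijective fillings of the boxes of $\lambda$ with $1,\dots,|\lambda|$ increasing from left to right along rows and from top to bottom along columns. $\binom{z}{2k}=z(z-1)\cdots(z-2k+1)/(2k)!$. *)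

theory Defs
  imports Complex_Main "HOL-Library.FuncSet"
begin

definition strict_partition :: "nat list \<Rightarrow> bool" where
  "strict_partition lam \<longleftrightarrow> sorted_wrt (>) lam \<and> (\<forall>x\<in>set lam. 0 < x)"

definition part :: "nat list \<Rightarrow> nat \<Rightarrow> nat" where
  "part lam i = (if 1 \<le> i \<and> i \<le> length lam then lam ! (i - 1) else 0)"

definition psize :: "nat list \<Rightarrow> nat" where
  "psize lam = sum_list lam"

definition plength :: "nat list \<Rightarrow> nat" where
  "plength lam = length lam"

definition shifted_diagram :: "nat list \<Rightarrow> (nat \<times> nat) set" where
  "shifted_diagram lam = {(i, j). 1 \<le> i \<and> i \<le> length lam \<and> i + 1 \<le> j \<and> j \<le> i + part lam i}"

definition content :: "nat \<times> nat \<Rightarrow> int" where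
  "content b = int (snd b) - int (fst b)"

definition hook_length :: "nat list \<Rightarrow> nat \<times> nat \<Rightarrow> nat" where
  "hook_length lam b =
     card {(i', j'). (i', j') \<in> shifted_diagram lam \<and> i' = fst b \<and> j' > snd b}
   + card {(i', j'). (i', j') \<in> shifted_diagram lam \<and> j' = snd b \<and> i' > fst b}
   + 1 + part lam (snd b)"

definition hook_product :: "nat list \<Rightarrow> nat" where
  "hook_product lam = (\<Prod>b\<in>shifted_diagram lam. hook_length lam b)"

definition standard_shifted_tableaux :: "nat list \<Rightarrow> (nat \<times> nat \<Rightarrow> nat) set" where
  "standard_shifted_tableaux lam =
     {T \<in> shifted_diagram lam \<rightarrow>\<^sub>E {1..psize lam}.
        bij_betw T (shifted_diagram lam) {1..psize lam} \<and>
        (\<forall>i j j'. (i, j) \<in> shifted_diagram lam \<longrightarrow> (i, j') \<in> shifted_diagram lam \<longrightarrow> j < j'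
                  \<longrightarrow> T (i, j) < T (i, j')) \<and>
        (\<forall>i i' j. (i, j) \<in> shifted_diagram lam \<longrightarrow> (i', j) \<in> shifted_diagram lam \<longrightarrow> i < i'
                  \<longrightarrow> T (i, j) < T (i', j))}"

definition num_sshyt :: "nat list \<Rightarrow> nat" where
  "num_sshyt lam = card (standard_shifted_tableaux lam)"

end

theory Submission
  imports "HOL-Computational_Algebra.Polynomial_FPS" Defs
begin

text \<open>A strict partition is identified with its set \<open>S\<close> of parts. The recursion for the number of
  standard fillings turns the sum over partitions of size \<open>n\<close> into the expectation after \<open>n\<close> steps of a
  Markov chain that turns a part \<open>a\<close> into \<open>a + 1\<close>, where \<open>a = 0\<close> stands for a new part. By the product
  formula for the hook lengths, the transition probabilities are the residues of
  \[ \frac{1}{z} \prod_{b \in S} \frac{z - b(b-1)/2}{z - b(b+1)/2} \]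
  at the poles \<open>z = a(a+1)/2\<close>. Hence the moments \<open>h\<^sub>r(S)\<close> of \<open>a(a+1)/2\<close> are the coefficients of a product
  over the parts. One step of the chain changes \<open>h\<^sub>r\<close> by a polynomial in \<open>a(a+1)/2\<close> and in the \<open>h\<^sub>s\<close>, and
  taking expectations turns the powers of \<open>a(a+1)/2\<close> into moments again, with a drop in weight if \<open>h\<^sub>r\<close>
  has weight \<open>r\<close>. So expectations of elements of weight \<open>d\<close> are polynomials of degree at most \<open>d\<close> in \<open>n\<close>.

  The expected increment of the content sum is the expectation of a polynomial of degree \<open>k\<close> in
  \<open>a(a+1)/2\<close>, so the expected content sum has degree at most \<open>k + 1\<close> in \<open>n\<close>. It vanishes for
  \<open>n \<le> k\<close>, because all contents are then at most \<open>k\<close>, and for \<open>n = k + 1\<close> only the one-row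
  partition contributes. This determines it.\<close>

section \<open>Moments of the transition probabilities\<close>

text \<open>Both are \<open>c * (c - 1) / 2\<close> for the content \<open>c\<close> of a box: the
  box that extends a part \<open>a\<close> has content \<open>a + 1\<close>, and the last box of a
  part \<open>b\<close> has content \<open>b\<close>.\<close>

definition up_node :: "nat \<Rightarrow> real" where "up_node a = real a * (real a + 1) / 2"
definition down_node :: "nat \<Rightarrow> real" where "down_node b = real b * (real b - 1) / 2"

lemma up_node_0 [simp]: "up_node 0 = 0" by (simp add: up_node_def)

lemma down_node_Suc: "down_node (Suc a) = up_node a"
  by (simp add: up_node_def down_node_def)

lemma up_minus_up: "up_node a - up_node b = (real a + 1 + real b) * (real a - real b) / 2"
  by (simp add: up_node_def field_simps)

lemma up_minus_down: "up_node a - down_node b = (real a + 1 - real b) * (real a + real b) / 2"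
  by (simp add: up_node_def down_node_def field_simps)

lemma up_node_eq_iff [simp]: "up_node a = up_node b \<longleftrightarrow> a = b"
proof
  assume "up_node a = up_node b"
  then have "(real a + 1 + real b) * (real a - real b) = 0" using up_minus_up[of a b] by simp
  moreover have "real a + 1 + real b \<noteq> 0" by linarith
  ultimately show "a = b" by simp
qed simp

text \<open>The residue at the pole \<open>up_node a\<close>. The element 0 in the denominator
  accounts for the factor \<open>1 / z\<close>.\<close>

definition trans_prob :: "nat set \<Rightarrow> nat \<Rightarrow> real" where
  "trans_prob S a = (\<Prod>b\<in>S. up_node a - down_node b) / (\<Prod>b\<in>insert 0 S - {a}. up_node a - up_node b)"

definition moment :: "nat set \<Rightarrow> nat \<Rightarrow> real" where
  "moment S r = (\<Sum>a\<in>insert 0 S. trans_prob S a * up_node a ^ r)"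

lemma lagrange_interpolation:
  fixes x :: "'a \<Rightarrow> real" and p :: "real poly"
  assumes A: "finite A" "inj_on x A" and deg: "degree p < card A"
  shows "poly p z = (\<Sum>a\<in>A. poly p (x a) / (\<Prod>b\<in>A-{a}. x a - x b) * (\<Prod>b\<in>A-{a}. z - x b))"
proof -
  define q where "q = (\<Sum>a\<in>A. smult (poly p (x a) / (\<Prod>b\<in>A-{a}. x a - x b)) (\<Prod>b\<in>A-{a}. [:- x b, 1:]))"
  have q: "poly q z = (\<Sum>a\<in>A. poly p (x a) / (\<Prod>b\<in>A-{a}. x a - x b) * (\<Prod>b\<in>A-{a}. z - x b))" for z
    by (simp add: q_def poly_sum poly_prod)
  have deg_q: "degree q < card A"
  proof -
    have "degree (smult (poly p (x a) / (\<Prod>b\<in>A-{a}. x a - x b)) (\<Prod>b\<in>A-{a}. [:- x b, 1:])) \<le> card A - 1"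
      if "a \<in> A" for a
    proof -
      have "degree (\<Prod>b\<in>A-{a}. [:- x b, 1:]) \<le> card (A - {a})"
        using degree_prod_sum_le[of "A - {a}" "\<lambda>b. [:- x b, 1:]"] A by (simp add: o_def)
      also have "\<dots> = card A - 1" using that A by simp
      finally show ?thesis using degree_smult_le le_trans by blast
    qed
    then have "degree q \<le> card A - 1" unfolding q_def using A(1) by (intro degree_sum_le) auto
    then show ?thesis using deg by linarith
  qed
  have "poly p z = poly q z" if z: "z \<in> x ` A" for z
  proof -
    obtain c where c: "c \<in> A" "z = x c" using z by blast
    have "poly q z = (\<Sum>a\<in>A. if a = c then poly p (x c) else 0)"
      unfolding q
    proof (rule sum.cong)
      fix a assume a: "a \<in> A"
      show "poly p (x a) / (\<Prod>b\<in>A-{a}. x a - x b) * (\<Prod>b\<in>A-{a}. z - x b) = (if a = c then poly p (x c) else 0)"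
      proof (cases "a = c")
        case True
        have "(\<Prod>b\<in>A-{a}. x a - x b) \<noteq> 0" using A a by (auto simp: inj_on_def)
        then show ?thesis using True c by simp
      next
        case False
        have "(\<Prod>b\<in>A-{a}. z - x b) = 0" using A c False by (intro prod_zero) auto
        then show ?thesis using False by simp
      qed
    qed simp
    then show ?thesis using c A by simp
  qed
  moreover have "card (x ` A) = card A" using A by (simp add: card_image)
  ultimately have "p = q" using deg deg_q by (intro poly_eqI_degree[of "x ` A"]) auto
  then have "poly p z = poly q z" by (rule arg_cong)
  then show ?thesis unfolding q .
qed

text \<open>Lagrange interpolation of \<open>\<Prod>b\<in>S. z - down_node b\<close> at the nodes, rewritten in \<open>t = 1 / z\<close>.\<close>

lemma partial_fractions_poly:
  assumes S: "finite S" "0 \<notin> S"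
  shows "(\<Prod>b\<in>S. [:1, - down_node b:])
         = (\<Sum>a\<in>insert 0 S. smult (trans_prob S a) (\<Prod>b\<in>insert 0 S - {a}. [:1, - up_node b:]))"
    (is "?P = ?Q")
proof -
  have "poly ?P t = poly ?Q t" if t: "t \<noteq> 0" for t
  proof -
    define p where "p = (\<Prod>b\<in>S. [:- down_node b, 1:])"
    have "degree p < card (insert 0 S)"
      using degree_prod_sum_le[OF S(1), of "\<lambda>b. [:- down_node b, 1:]"] S by (simp add: p_def o_def)
    then have L: "poly p (1/t) = (\<Sum>a\<in>insert 0 S. poly p (up_node a) / (\<Prod>b\<in>insert 0 S-{a}. up_node a - up_node b)
        * (\<Prod>b\<in>insert 0 S-{a}. 1/t - up_node b))"
      using S by (intro lagrange_interpolation) (auto simp: inj_on_def)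
    have scale: "t ^ card R * (\<Prod>b\<in>R. 1/t - v b) = (\<Prod>b\<in>R. 1 - t * v b)" for R and v :: "nat \<Rightarrow> real"
    proof -
      have "t ^ card R * (\<Prod>b\<in>R. 1/t - v b) = (\<Prod>b\<in>R. t * (1/t - v b))" by (simp add: prod.distrib)
      also have "\<dots> = (\<Prod>b\<in>R. 1 - t * v b)" using t by (simp add: right_diff_distrib)
      finally show ?thesis .
    qed
    have card: "card (insert 0 S - {a}) = card S" if "a \<in> insert 0 S" for a
      using S that by (simp add: card_Diff_singleton)
    have "poly ?P t = t ^ card S * poly p (1/t)"
      by (simp add: p_def poly_prod scale)
    also have "\<dots> = (\<Sum>a\<in>insert 0 S. trans_prob S a * (t ^ card S * (\<Prod>b\<in>insert 0 S-{a}. 1/t - up_node b)))"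
      unfolding L by (simp only: sum_distrib_left trans_prob_def p_def poly_prod) (simp add: mult_ac)
    also have "\<dots> = (\<Sum>a\<in>insert 0 S. trans_prob S a * (\<Prod>b\<in>insert 0 S-{a}. 1 - t * up_node b))"
      by (intro sum.cong refl) (metis scale card)
    also have "\<dots> = poly ?Q t"
      by (simp only: poly_sum poly_smult poly_prod) simp
    finally show ?thesis .
  qed
  \<comment> \<open>Agreement at the infinitely many nonzero \<open>t\<close> already forces
    equality of the polynomials.\<close>
  then have "{t. t \<noteq> 0} \<subseteq> {t. poly (?P - ?Q) t = 0}" by auto
  moreover have "infinite {t::real. t \<noteq> 0}"
    using infinite_UNIV_char_0 by (simp flip: Compl_eq)
  ultimately have "?P - ?Q = 0" using poly_roots_finite finite_subset by blast
  then show ?thesis by simp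
qed

definition moment_gf :: "nat set \<Rightarrow> real fps" where
  "moment_gf S = Abs_fps (moment S)"

abbreviation lin :: "real \<Rightarrow> real fps" where "lin c \<equiv> 1 - fps_const c * fps_X"

lemma fps_of_poly_lin: "fps_of_poly [:1, - c:] = lin c"
  by (rule fps_ext) (auto simp: coeff_pCons split: nat.split)

lemma geometric_lin: "Abs_fps (\<lambda>r. c ^ r) * lin c = 1"
proof (rule fps_ext)
  fix n show "fps_nth (Abs_fps (\<lambda>r. c ^ r) * lin c) n = fps_nth 1 n"
    by (cases n) (simp_all add: right_diff_distrib mult.assoc[symmetric])
qed

text \<open>\<open>moment_gf S\<close> is a sum of geometric series, one per node. Multiplying by
  the common denominator turns the claim into the partial fraction identity and keeps inverses of
  power series out of the statement.\<close>

lemma moment_gf_mult: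
  assumes S: "finite S" "0 \<notin> S"
  shows "moment_gf S * (\<Prod>b\<in>S. lin (up_node b)) = (\<Prod>b\<in>S. lin (down_node b))"
proof -
  have gf: "moment_gf S = (\<Sum>a\<in>insert 0 S. fps_const (trans_prob S a) * Abs_fps (\<lambda>r. up_node a ^ r))"
    by (rule fps_ext) (simp only: moment_gf_def moment_def fps_sum_nth fps_mult_left_const_nth fps_nth_Abs_fps)
  \<comment> \<open>The added factor for 0 is \<open>lin 0\<close>, which is 1.\<close>
  have "(\<Prod>b\<in>S. lin (up_node b)) = (\<Prod>b\<in>insert 0 S. lin (up_node b))"
    using S by simp
  then have "moment_gf S * (\<Prod>b\<in>S. lin (up_node b))
    = (\<Sum>a\<in>insert 0 S. fps_const (trans_prob S a) * Abs_fps (\<lambda>r. up_node a ^ r) * (\<Prod>b\<in>insert 0 S. lin (up_node b)))"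
    by (simp only: gf sum_distrib_right)
  also have "\<dots> = (\<Sum>a\<in>insert 0 S. fps_const (trans_prob S a) * (\<Prod>b\<in>insert 0 S - {a}. lin (up_node b)))"
  proof (rule sum.cong)
    fix a assume a: "a \<in> insert 0 S"
    have "(\<Prod>b\<in>insert 0 S. lin (up_node b)) = lin (up_node a) * (\<Prod>b\<in>insert 0 S - {a}. lin (up_node b))"
      using S a by (intro prod.remove) auto
    then show "fps_const (trans_prob S a) * Abs_fps (\<lambda>r. up_node a ^ r) * (\<Prod>b\<in>insert 0 S. lin (up_node b))
        = fps_const (trans_prob S a) * (\<Prod>b\<in>insert 0 S - {a}. lin (up_node b))"
      by (metis (no_types, lifting) geometric_lin mult.assoc mult_1)
  qed simp
  also have "\<dots> = fps_of_poly (\<Prod>b\<in>S. [:1, - down_node b:])"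
    unfolding partial_fractions_poly[OF S] fps_of_poly_sum fps_of_poly_smult fps_of_poly_prod fps_of_poly_lin ..
  also have "\<dots> = (\<Prod>b\<in>S. lin (down_node b))"
    unfolding fps_of_poly_prod fps_of_poly_lin ..
  finally show ?thesis .
qed

text \<open>The constant coefficients of the generating function identity show that the transition
  probabilities sum to 1.\<close>

lemma moment_0: 
  assumes S: "finite S" "0 \<notin> S"
  shows "moment S 0 = 1"
proof -
  have "fps_nth (\<Prod>b\<in>R. lin (v b)) 0 = 1" for R and v :: "nat \<Rightarrow> real"
    by (induction R rule: infinite_finite_induct) simp_all
  then show ?thesis
    using arg_cong[OF moment_gf_mult[OF S], of "\<lambda>f. fps_nth f 0"] by (simp add: moment_gf_def)
qed

definition grow :: "nat set \<Rightarrow> nat \<Rightarrow> nat set" where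
  "grow S a = insert (Suc a) (S - {a})"

text \<open>Only the factors of the part \<open>a\<close> change: they become those of
  \<open>Suc a\<close>, and \<open>down_node (Suc a) = up_node a\<close> is where the second factor
  \<open>lin (up_node a)\<close> comes from.\<close>

lemma moment_gf_grow:
  assumes S: "finite S" "0 \<notin> S" and a: "a \<in> insert 0 S" "Suc a \<notin> S"
  shows "moment_gf (grow S a) * (lin (down_node a) * lin (up_node (Suc a))) = moment_gf S * (lin (up_node a))\<^sup>2"
proof -
  let ?R = "S - {a}"
  define u where "u = (\<Prod>b\<in>?R. lin (up_node b))"
  define d where "d = (\<Prod>b\<in>?R. lin (down_node b))"
  have nz: "lin c \<noteq> 0" for c
  proof
    assume "lin c = 0"
    then have "fps_nth (lin c) 0 = 0" by simp
    then show False by simp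
  qed
  have u: "u \<noteq> 0" unfolding u_def using S nz by (auto simp: prod_zero_iff)
  have T: "finite (grow S a)" "0 \<notin> grow S a" using S by (auto simp: grow_def)
  have 1: "moment_gf (grow S a) * (lin (up_node (Suc a)) * u) = lin (up_node a) * d"
    using moment_gf_mult[OF T] S a by (simp add: grow_def u_def d_def down_node_Suc)
  \<comment> \<open>This covers a new part as well: for \<open>a = 0\<close> the split-off factor is
    \<open>lin 0\<close>.\<close>
  have split: "(\<Prod>b\<in>S. lin (v b)) = lin (v a) * (\<Prod>b\<in>?R. lin (v b))" if "v 0 = 0" for v
  proof (cases "a \<in> S")
    case True
    then show ?thesis using S by (simp add: prod.remove)
  next
    case False
    then show ?thesis using a that by simp
  qed
  have 2: "moment_gf S * (lin (up_node a) * u) = lin (down_node a) * d"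
    using moment_gf_mult[OF S] split[of up_node] split[of down_node]
    by (simp add: u_def d_def down_node_def)
  have "moment_gf (grow S a) * (lin (down_node a) * lin (up_node (Suc a))) * u
     = lin (down_node a) * (moment_gf (grow S a) * (lin (up_node (Suc a)) * u))"
    by (simp only: mult_ac)
  also have "\<dots> = lin (up_node a) * (moment_gf S * (lin (up_node a) * u))"
    unfolding 1 2 by (simp only: mult_ac)
  also have "\<dots> = moment_gf S * (lin (up_node a))\<^sup>2 * u"
    by (simp only: mult_ac power2_eq_square)
  finally show ?thesis using u by simp
qed

text \<open>Coefficients of \<open>moment_gf_grow\<close>. The nodes \<open>down_node a\<close> and
  \<open>up_node (Suc a)\<close> have sum \<open>2 * x + 1\<close> and product
  \<open>x\<^sup>2 - x\<close>, so \<open>a\<close> enters only through \<open>x\<close>.\<close>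

lemma moment_grow_rec:
  assumes S: "finite S" "0 \<notin> S" and a: "a \<in> insert 0 S" "Suc a \<notin> S"
  defines "x \<equiv> up_node a" and "h \<equiv> moment S" and "h' \<equiv> moment (grow S a)"
  shows "h' (Suc 0) - h (Suc 0) = h' 0 + 2 * x * (h' 0 - h 0)"
    and "h' (Suc (Suc r)) - h (Suc (Suc r)) = h' (Suc r) + x * h' r
          + 2 * x * (h' (Suc r) - h (Suc r)) - x\<^sup>2 * (h' r - h r)"
proof -
  let ?c = "2 * x + 1" and ?e = "x\<^sup>2 - x"
  have quad: "lin u * lin v = 1 - fps_const (u + v) * fps_X + fps_const (u * v) * (fps_X * fps_X)" for u v
    unfolding fps_const_add[symmetric] fps_const_mult[symmetric] by (simp only: algebra_simps mult_1)
  have 1: "down_node a + up_node (Suc a) = ?c"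
    by (simp add: x_def up_node_def down_node_def field_simps)
  have 2: "down_node a * up_node (Suc a) = ?e"
    by (simp add: x_def up_node_def down_node_def field_simps power2_eq_square)
  have gf: "moment_gf (grow S a) * (1 - fps_const ?c * fps_X + fps_const ?e * (fps_X * fps_X))
    = moment_gf S * (1 - fps_const (2 * x) * fps_X + fps_const (x\<^sup>2) * (fps_X * fps_X))"
    using moment_gf_grow[OF S a] quad[of "down_node a" "up_node (Suc a)"] quad[of x x] 
    unfolding power2_eq_square 1 2 x_def[symmetric] by (simp add: power2_eq_square)
  have coeff: "fps_nth (F * (1 - fps_const c * fps_X + fps_const e * (fps_X * fps_X))) n
     = fps_nth F n - c * (if n = 0 then 0 else fps_nth F (n - 1)) + e * (if n < 2 then 0 else fps_nth F (n - 2))"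
    for F and c e :: real and n
  proof -
    have "F * (1 - fps_const c * fps_X + fps_const e * (fps_X * fps_X))
       = F - fps_const c * (F * fps_X) + fps_const e * (F * fps_X * fps_X)"
      by (simp add: algebra_simps)
    then show ?thesis by (cases n) (auto simp: numeral_2_eq_2)
  qed
  show "h' (Suc 0) - h (Suc 0) = h' 0 + 2 * x * (h' 0 - h 0)"
    using arg_cong[OF gf, of "\<lambda>F. fps_nth F (Suc 0)"] unfolding coeff
    by (simp add: moment_gf_def h_def h'_def algebra_simps)
  show "h' (Suc (Suc r)) - h (Suc (Suc r)) = h' (Suc r) + x * h' r
          + 2 * x * (h' (Suc r) - h (Suc r)) - x\<^sup>2 * (h' r - h r)"
    using arg_cong[OF gf, of "\<lambda>F. fps_nth F (Suc (Suc r))"] unfolding coeff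
    by (simp add: moment_gf_def h_def h'_def algebra_simps)
qed

section \<open>Weights and polynomial growth\<close>

definition moments :: "nat list \<Rightarrow> nat set \<Rightarrow> real" where
  "moments rs S = prod_list (map (moment S) rs)"

lemma moments_simps [simp]:
  "moments [] S = 1" "moments (r # rs) S = moment S r * moments rs S"
  "moments (rs @ ss) S = moments rs S * moments ss S"
  by (simp_all add: moments_def)

text \<open>The moment of index \<open>r\<close> has weight \<open>r\<close> and the variable \<open>x\<close>, which stands for \<open>up_node a\<close>, has
  weight \<open>1\<close>. The bound is strict so that the set for \<open>0\<close> only contains the zero function.\<close>

inductive_set weight_below :: "nat \<Rightarrow> (nat set \<Rightarrow> real \<Rightarrow> real) set" for d where
  zero: "(\<lambda>S x. 0) \<in> weight_below d"
| add_monomial: "g \<in> weight_below d \<Longrightarrow> sum_list rs + j < d \<Longrightarrow>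
     (\<lambda>S x. c * moments rs S * x ^ j + g S x) \<in> weight_below d"

lemma weight_below_monomial:
  "sum_list rs + j < d \<Longrightarrow> (\<lambda>S x. c * moments rs S * x ^ j) \<in> weight_below d"
  using weight_below.add_monomial[OF weight_below.zero, of rs j d c] by simp

lemma weight_below_mono: "g \<in> weight_below d \<Longrightarrow> d \<le> e \<Longrightarrow> g \<in> weight_below e"
proof (induction rule: weight_below.induct)
  case zero
  show ?case by (rule weight_below.zero)
next
  case (add_monomial g rs j c)
  then show ?case by (intro weight_below.add_monomial) auto
qed

lemma weight_below_add:
  assumes "f \<in> weight_below d" "g \<in> weight_below d"
  shows "(\<lambda>S x. f S x + g S x) \<in> weight_below d"
  using assms(1)
proof induction
  case zero
  then show ?case using assms(2) by simp
next
  case (add_monomial f rs j c)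
  from weight_below.add_monomial[OF add_monomial.IH add_monomial.hyps(2)]
  show ?case by (simp add: add.assoc)
qed

lemma weight_below_mult_monomial:
  assumes "g \<in> weight_below d" "sum_list rs + j \<le> m"
  shows "(\<lambda>S x. c * moments rs S * x ^ j * g S x) \<in> weight_below (d + m)"
  using assms(1)
proof induction
  case zero
  then show ?case using weight_below.zero by simp
next
  case (add_monomial g ss i c')
  have "(\<lambda>S x. (c * c') * moments (rs @ ss) S * x ^ (j + i) + c * moments rs S * x ^ j * g S x) \<in> weight_below (d + m)"
    using add_monomial assms(2) by (intro weight_below.add_monomial) auto
  then show ?case by (simp add: algebra_simps power_add)
qed

lemma weight_below_mult:
  assumes "f \<in> weight_below d" "g \<in> weight_below e"
  shows "(\<lambda>S x. f S x * g S x) \<in> weight_below (d + e)"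
  using assms(1)
proof induction
  case zero
  then show ?case using weight_below.zero by simp
next
  case (add_monomial f rs j c)
  have "(\<lambda>S x. c * moments rs S * x ^ j * g S x) \<in> weight_below (e + d)"
    using assms(2) add_monomial by (intro weight_below_mult_monomial) auto
  from weight_below_add[OF this[unfolded add.commute[of e d]] add_monomial.IH]
  show ?case by (simp add: algebra_simps)
qed

definition addable :: "nat set \<Rightarrow> nat \<Rightarrow> bool" where
  "addable S a \<longleftrightarrow> finite S \<and> 0 \<notin> S \<and> a \<in> insert 0 S \<and> Suc a \<notin> S"

text \<open>The drop in weight: strong induction along \<open>moment_grow_rec\<close>, where every
  term of the recursion stays strictly below weight \<open>r\<close>.\<close>

lemma moment_increment:
  "\<exists>g\<in>weight_below r. \<forall>S a. addable S a \<longrightarrow> moment (grow S a) r - moment S r = g S (up_node a)"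
proof (induction r rule: less_induct)
  case (less r)
  have m0: "moment (grow S a) 0 = 1" "moment S 0 = 1" if "addable S a" for S a
    using that by (auto simp: addable_def grow_def intro!: moment_0)
  consider "r = 0" | "r = Suc 0" | q where "r = Suc (Suc q)" by (metis not0_implies_Suc)
  then show ?case
  proof cases
    case 1
    then show ?thesis using weight_below.zero m0 by force
  next
    case 2
    show ?thesis
    proof (intro bexI allI impI)
      show "(\<lambda>S x. 1 * moments [] S * x ^ 0) \<in> weight_below r"
        using 2 by (intro weight_below_monomial) simp
      fix S a assume "addable S a"
      then show "moment (grow S a) r - moment S r = 1 * moments [] S * up_node a ^ 0"
        using moment_grow_rec(1)[of S a] m0[of S a] 2 by (simp add: addable_def)
    qed
  next
    case (3 q)
    obtain g1 g0 where g: "g1 \<in> weight_below (Suc q)" "g0 \<in> weight_below q"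
      and inc: "\<And>S a. addable S a \<Longrightarrow> moment (grow S a) (Suc q) - moment S (Suc q) = g1 S (up_node a)"
        "\<And>S a. addable S a \<Longrightarrow> moment (grow S a) q - moment S q = g0 S (up_node a)"
      using less[of "Suc q"] less[of q] 3 by auto
    \<comment> \<open>The recursion with each moment of \<open>grow S a\<close> on its right-hand
      side written as the moment of \<open>S\<close> plus its increment \<open>g1\<close> or
      \<open>g0\<close>.\<close>
    define G where "G = (\<lambda>S x. (1 * moments [Suc q] S * x ^ 0 + (1 * moments [q] S * x ^ 1 + g1 S x))
       + ((1 * moments [] S * x ^ 1 * g0 S x) + (2 * moments [] S * x ^ 1 * g1 S x + (-1) * moments [] S * x ^ 2 * g0 S x)))"
    have "G \<in> weight_below r"
      unfolding G_def
    proof (intro weight_below_add)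
      show "(\<lambda>S x. 1 * moments [Suc q] S * x ^ 0) \<in> weight_below r"
        using 3 by (intro weight_below_monomial) simp
      show "(\<lambda>S x. 1 * moments [q] S * x ^ 1) \<in> weight_below r"
        using 3 by (intro weight_below_monomial) simp
      show "g1 \<in> weight_below r" using g 3 weight_below_mono by simp
      show "(\<lambda>S x. 1 * moments [] S * x ^ 1 * g0 S x) \<in> weight_below r"
        using weight_below_mult_monomial[OF g(2), of "[]" 1 2 1] 3 by simp
      show "(\<lambda>S x. 2 * moments [] S * x ^ 1 * g1 S x) \<in> weight_below r"
        using weight_below_mult_monomial[OF g(1), of "[]" 1 1 2] 3 by simp
      show "(\<lambda>S x. (-1) * moments [] S * x ^ 2 * g0 S x) \<in> weight_below r"
        using weight_below_mult_monomial[OF g(2), of "[]" 2 2 "-1"] 3 by simp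
    qed
    moreover have "moment (grow S a) r - moment S r = G S (up_node a)" if A: "addable S a" for S a
    proof -
      have h: "moment (grow S a) (Suc q) = moment S (Suc q) + g1 S (up_node a)"
        "moment (grow S a) q = moment S q + g0 S (up_node a)" using inc[OF A] by simp_all
      show ?thesis
        using moment_grow_rec(2)[of S a q] A unfolding 3 h by (simp add: addable_def G_def algebra_simps)
    qed
    ultimately show ?thesis by blast
  qed
qed

text \<open>Discrete product rule: the increment of a product is the sum of two mixed terms and the
  product of the increments. In each term at least one moment is replaced by something of smaller
  weight.\<close>

lemma moments_increment:
  "\<exists>g\<in>weight_below (sum_list rs). \<forall>S a. addable S a \<longrightarrow> moments rs (grow S a) - moments rs S = g S (up_node a)"
proof (induction rs)
  case Nil
  then show ?case using weight_below.zero by force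
next
  case (Cons r rs)
  obtain g where g: "g \<in> weight_below (sum_list rs)"
    and g_inc: "\<And>S a. addable S a \<Longrightarrow> moments rs (grow S a) - moments rs S = g S (up_node a)"
    using Cons by blast
  obtain f where f: "f \<in> weight_below r"
    and f_inc: "\<And>S a. addable S a \<Longrightarrow> moment (grow S a) r - moment S r = f S (up_node a)"
    using moment_increment by blast
  let ?G = "\<lambda>S x. 1 * moments [r] S * x ^ 0 * g S x + (1 * moments rs S * x ^ 0 * f S x + f S x * g S x)"
  have "?G \<in> weight_below (sum_list (r # rs))"
  proof (intro weight_below_add)
    show "(\<lambda>S x. 1 * moments [r] S * x ^ 0 * g S x) \<in> weight_below (sum_list (r # rs))"
      using weight_below_mult_monomial[OF g, of "[r]" 0 r 1] by (simp add: add.commute)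
    show "(\<lambda>S x. 1 * moments rs S * x ^ 0 * f S x) \<in> weight_below (sum_list (r # rs))"
      using weight_below_mult_monomial[OF f, of rs 0 "sum_list rs" 1] by simp
    show "(\<lambda>S x. f S x * g S x) \<in> weight_below (sum_list (r # rs))"
      using weight_below_mult[OF f g] by simp
  qed
  moreover have "moments (r # rs) (grow S a) - moments (r # rs) S = ?G S (up_node a)" if A: "addable S a" for S a
  proof -
    have h: "moments rs (grow S a) = moments rs S + g S (up_node a)"
      "moment (grow S a) r = moment S r + f S (up_node a)" using g_inc[OF A] f_inc[OF A] by simp_all
    show ?thesis by (simp add: h algebra_simps)
  qed
  ultimately show ?case by (intro bexI[of _ ?G]) auto
qed

text \<open>Polynomials in \<open>n\<close> of degree below \<open>d\<close>, in the Newton basis,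
  on which forward differences act as an index shift. The strict bound matches that of
  \<open>weight_below\<close>.\<close>

definition binomial_comb :: "nat \<Rightarrow> (nat \<Rightarrow> real) \<Rightarrow> bool" where
  "binomial_comb d \<phi> \<longleftrightarrow> (\<exists>c. \<forall>n. \<phi> n = (\<Sum>j<d. c j * real (n choose j)))"

lemma binomial_comb_zero: "binomial_comb d (\<lambda>n. 0)"
  unfolding binomial_comb_def by (rule exI[of _ "\<lambda>j. 0"]) simp

lemma binomial_comb_scale_add:
  assumes "binomial_comb d \<phi>" "binomial_comb d \<psi>"
  shows "binomial_comb d (\<lambda>n. a * \<phi> n + \<psi> n)"
proof -
  obtain c e where "\<And>n. \<phi> n = (\<Sum>j<d. c j * real (n choose j))" "\<And>n. \<psi> n = (\<Sum>j<d. e j * real (n choose j))"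
    using assms unfolding binomial_comb_def by blast
  then show ?thesis unfolding binomial_comb_def
    by (intro exI[of _ "\<lambda>j. a * c j + e j"]) (simp add: sum_distrib_left algebra_simps sum.distrib)
qed

lemma binomial_comb_mono:
  assumes "binomial_comb d \<phi>" "d \<le> e"
  shows "binomial_comb e \<phi>"
proof -
  obtain c where c: "\<And>n. \<phi> n = (\<Sum>j<d. c j * real (n choose j))"
    using assms unfolding binomial_comb_def by blast
  have "(\<Sum>j<d. c j * real (n choose j)) = (\<Sum>j<e. (if j < d then c j else 0) * real (n choose j))" for n
    using assms(2) by (intro sum.mono_neutral_cong_left) auto
  then show ?thesis unfolding binomial_comb_def c by (intro exI[of _ "\<lambda>j. if j < d then c j else 0"]) simp
qed

text \<open>By Pascal's rule \<open>n choose Suc j\<close> has the difference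
  \<open>n choose j\<close>, so summation raises each index by one. The initial value becomes the
  coefficient of \<open>n choose 0\<close>.\<close>

lemma binomial_comb_sum:
  assumes "binomial_comb d (\<lambda>n. \<phi> (Suc n) - \<phi> n)"
  shows "binomial_comb (Suc d) \<phi>"
proof -
  obtain c where c: "\<And>n. \<phi> (Suc n) - \<phi> n = (\<Sum>j<d. c j * real (n choose j))"
    using assms unfolding binomial_comb_def by blast
  have eq: "\<phi> n = \<phi> 0 + (\<Sum>j<d. c j * real (n choose Suc j))" for n
  proof (induction n)
    case (Suc n)
    then show ?case using c[of n] by (simp add: algebra_simps sum.distrib)
  qed simp
  have "\<phi> n = (\<Sum>j<Suc d. (case j of 0 \<Rightarrow> \<phi> 0 | Suc i \<Rightarrow> c i) * real (n choose j))" for n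
    unfolding sum.lessThan_Suc_shift by (subst eq) simp
  then show ?thesis unfolding binomial_comb_def by blast
qed

text \<open>Evaluation at \<open>0, ..., d\<close> is a triangular system with unit diagonal: the
  zeros kill the coefficients one after another and leave only the top one.\<close>

lemma binomial_comb_eq_top:
  assumes \<phi>: "binomial_comb (Suc d) \<phi>" and zero: "\<And>n. n < d \<Longrightarrow> \<phi> n = 0"
  shows "\<phi> n = \<phi> d * real (n choose d)"
proof -
  obtain c where c: "\<And>n. \<phi> n = (\<Sum>j<Suc d. c j * real (n choose j))"
    using \<phi> unfolding binomial_comb_def by blast
  have ev: "\<phi> m = c m" if m: "m \<le> d" and lower: "\<And>j. j < m \<Longrightarrow> c j = 0" for m
  proof -
    have "\<phi> m = (\<Sum>j<Suc d. if j = m then c m else 0)"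
      unfolding c using lower by (intro sum.cong refl) (auto simp: neq_iff)
    then show ?thesis using m by simp
  qed
  have c0: "c j = 0" if "j < d" for j
    using that
  proof (induction j rule: less_induct)
    case (less j)
    then show ?case using ev[of j] zero[of j] by simp
  qed
  have "\<phi> d = c d" using ev c0 by simp
  then show ?thesis using c[of n] c0 by simp
qed

section \<open>Standard fillings and corner removal\<close>

text \<open>Stated for an arbitrary set of boxes, with \<open>card D\<close> as the number of
  entries, so that a box can be deleted without naming the resulting partition.\<close>

definition std_fillings :: "(nat \<times> nat) set \<Rightarrow> (nat \<times> nat \<Rightarrow> nat) set" where
  "std_fillings D = {T \<in> D \<rightarrow>\<^sub>E {1..card D}. bij_betw T D {1..card D} \<and>
     (\<forall>i j j'. (i, j) \<in> D \<longrightarrow> (i, j') \<in> D \<longrightarrow> j < j' \<longrightarrow> T (i, j) < T (i, j')) \<and>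
     (\<forall>i i' j. (i, j) \<in> D \<longrightarrow> (i', j) \<in> D \<longrightarrow> i < i' \<longrightarrow> T (i, j) < T (i', j))}"

definition corners :: "(nat \<times> nat) set \<Rightarrow> (nat \<times> nat) set" where
  "corners D = {(i, j). (i, j) \<in> D \<and> (\<forall>j'>j. (i, j') \<notin> D) \<and> (\<forall>i'>i. (i', j) \<notin> D)}"

lemma finite_std_fillings: "finite D \<Longrightarrow> finite (std_fillings D)"
  unfolding std_fillings_def
  by (rule finite_subset[OF _ finite_PiE[of D "\<lambda>_. {1..card D}"]]) auto

lemma max_entry_corner:
  assumes T: "T \<in> std_fillings D" and b: "b \<in> D" "T b = card D"
  shows "b \<in> corners D"
proof -
  obtain i j where ij: "b = (i, j)" by fastforce
  have le: "T c \<le> card D" if "c \<in> D" for c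
    using T that unfolding std_fillings_def by (auto simp: PiE_iff)
  have "(i, j') \<notin> D" if "j' > j" for j'
  proof
    assume c: "(i, j') \<in> D"
    then have "T (i, j) < T (i, j')" using T b that ij unfolding std_fillings_def by blast
    then show False using le[OF c] b ij by simp
  qed
  moreover have "(i', j) \<notin> D" if "i' > i" for i'
  proof
    assume c: "(i', j) \<in> D"
    then have "T (i, j) < T (i', j)" using T b that ij unfolding std_fillings_def by blast
    then show False using le[OF c] b ij by simp
  qed
  ultimately show ?thesis using b ij by (auto simp: corners_def)
qed

lemma restrict_std_fillings:
  assumes D: "finite D" and b: "b \<in> D" and T: "T \<in> std_fillings D" "T b = card D"
  shows "restrict T (D - {b}) \<in> std_fillings (D - {b})"
proof -
  have N: "card D = Suc (card (D - {b}))" using D b by (metis card.remove)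
  have "bij_betw T (D - {b}) ({1..card D} - {card D})"
  proof (rule bij_betw_DiffI)
    show "bij_betw T {b} {card D}" using T(2) by (simp add: bij_betw_def)
    show "{card D} \<subseteq> {1..card D}" using N by (metis Suc_le_mono atLeastAtMost_iff empty_subsetI insert_subset le_refl One_nat_def zero_le)
  qed (use T b in \<open>auto simp: std_fillings_def\<close>)
  moreover have "{1..card D} - {card D} = {1..card (D - {b})}" unfolding N by auto
  ultimately have "bij_betw T (D - {b}) {1..card (D - {b})}" by (simp only:)
  then have bij: "bij_betw (restrict T (D - {b})) (D - {b}) {1..card (D - {b})}"
    by (rule bij_betw_cong[THEN iffD1, rotated]) auto
  then have "restrict T (D - {b}) \<in> (D - {b}) \<rightarrow>\<^sub>E {1..card (D - {b})}"
    by (auto simp: bij_betw_def PiE_iff)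
  then show ?thesis using bij T unfolding std_fillings_def by auto
qed

lemma extend_std_fillings:
  assumes D: "finite D" and b: "b \<in> corners D" and U: "U \<in> std_fillings (D - {b})"
  shows "U(b := card D) \<in> std_fillings D"
proof -
  have bD: "b \<in> D" using b by (auto simp: corners_def)
  have N: "card D = Suc (card (D - {b}))" using D bD by (metis card.remove)
  have lt: "U c < card D" if "c \<in> D - {b}" for c
  proof -
    have "U c \<in> {1..card (D - {b})}" using U that unfolding std_fillings_def by blast
    then show ?thesis unfolding N by simp
  qed
  have "bij_betw U (D - {b}) {1..card (D - {b})}" using U unfolding std_fillings_def by blast
  then have "bij_betw (U(b := card D)) (D - {b}) {1..card (D - {b})}"
    by (rule bij_betw_cong[THEN iffD1, rotated]) auto
  then have "bij_betw (U(b := card D)) (D - {b} \<union> {b}) ({1..card (D - {b})} \<union> {(U(b := card D)) b})"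
  proof (intro notIn_Un_bij_betw)
    show "(U(b := card D)) b \<notin> {1..card (D - {b})}" using N by (simp del: card_Diff_insert)
  qed simp_all
  moreover have "D - {b} \<union> {b} = D" using bD by auto
  moreover have "{1..card (D - {b})} \<union> {(U(b := card D)) b} = {1..card D}" unfolding N by auto
  ultimately have bij: "bij_betw (U(b := card D)) D {1..card D}" by simp
  have ext: "U(b := card D) \<in> D \<rightarrow>\<^sub>E {1..card D}"
    using bij U bD unfolding std_fillings_def by (auto simp: PiE_iff extensional_def bij_betw_def)
  have rows: "(U(b := card D)) (i, j) < (U(b := card D)) (i, j')"
    if "(i, j) \<in> D" "(i, j') \<in> D" "j < j'" for i j j'
  proof -
    \<comment> \<open>A corner has no box to its right, so the new maximal entry is never on the
      smaller side.\<close>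
    have "(i, j) \<noteq> b" using b that by (auto simp: corners_def)
    then show ?thesis using lt U that unfolding std_fillings_def by auto
  qed
  have cols: "(U(b := card D)) (i, j) < (U(b := card D)) (i', j)"
    if "(i, j) \<in> D" "(i', j) \<in> D" "i < i'" for i i' j
  proof -
    have "(i, j) \<noteq> b" using b that by (auto simp: corners_def)
    then show ?thesis using lt U that unfolding std_fillings_def by auto
  qed
  show ?thesis unfolding std_fillings_def using bij ext rows cols by blast
qed

text \<open>Fillings are sorted by the box of the largest entry, which has to be a corner. Deleting
  that box is inverted by putting the entry back.\<close>

lemma card_std_fillings:
  assumes D: "finite D" "D \<noteq> {}"
  shows "card (std_fillings D) = (\<Sum>b\<in>corners D. card (std_fillings (D - {b})))"
proof -
  define X where "X b = {T \<in> std_fillings D. T b = card D}" for b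
  have N: "card D \<in> {1..card D}" using D by (simp add: Suc_le_eq card_gt_0_iff)
  have cornersD: "corners D \<subseteq> D" by (auto simp: corners_def)
  have "\<exists>b\<in>corners D. T b = card D" if T: "T \<in> std_fillings D" for T
  proof -
    have "T ` D = {1..card D}" using T unfolding std_fillings_def by (auto simp: bij_betw_def)
    then obtain b where "b \<in> D" "T b = card D" using N by (metis imageE)
    then show ?thesis using max_entry_corner[OF T] by blast
  qed
  then have "std_fillings D = (\<Union>b\<in>corners D. X b)" by (auto simp: X_def)
  moreover have "card (\<Union>b\<in>corners D. X b) = (\<Sum>b\<in>corners D. card (X b))"
  proof (rule card_UN_disjoint)
    show "finite (corners D)" using D cornersD finite_subset by blast
    show "\<forall>b\<in>corners D. finite (X b)" using finite_std_fillings[OF D(1)] by (simp add: X_def)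
    show "\<forall>b\<in>corners D. \<forall>c\<in>corners D. b \<noteq> c \<longrightarrow> X b \<inter> X c = {}"
    proof (intro ballI impI)
      fix b c assume bc: "b \<in> corners D" "c \<in> corners D" "b \<noteq> c"
      have "T b \<noteq> T c" if "T \<in> std_fillings D" for T
        using that bc cornersD unfolding std_fillings_def bij_betw_def inj_on_def by blast
      then show "X b \<inter> X c = {}" by (auto simp: X_def) metis
    qed
  qed
  moreover have "card (X b) = card (std_fillings (D - {b}))" if b: "b \<in> corners D" for b
  proof (rule bij_betw_same_card)
    have bD: "b \<in> D" using b cornersD by blast
    show "bij_betw (\<lambda>T. restrict T (D - {b})) (X b) (std_fillings (D - {b}))"
    proof (rule bij_betw_byWitness[where f' = "\<lambda>U. U(b := card D)"])
      show "\<forall>T\<in>X b. (restrict T (D - {b}))(b := card D) = T"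
      proof (intro ballI ext)
        fix T c assume "T \<in> X b"
        then have "T b = card D" "T \<in> extensional D" by (auto simp: X_def std_fillings_def PiE_iff)
        then show "((restrict T (D - {b}))(b := card D)) c = T c"
          by (cases c) (auto simp: restrict_def extensional_def)
      qed
      show "\<forall>U\<in>std_fillings (D - {b}). restrict (U(b := card D)) (D - {b}) = U"
      proof (intro ballI ext)
        fix U c assume "U \<in> std_fillings (D - {b})"
        then have "U \<in> extensional (D - {b})" by (auto simp: std_fillings_def PiE_iff)
        then show "restrict (U(b := card D)) (D - {b}) c = U c"
          using extensional_arb[of U "D - {b}" c] by (auto simp: restrict_def)
      qed
      show "(\<lambda>T. restrict T (D - {b})) ` X b \<subseteq> std_fillings (D - {b})"
        using restrict_std_fillings[OF D(1) bD] by (auto simp: X_def)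
      show "(\<lambda>U. U(b := card D)) ` std_fillings (D - {b}) \<subseteq> X b"
        using extend_std_fillings[OF D(1) b] by (auto simp: X_def)
    qed
  qed
  ultimately show ?thesis by simp
qed

section \<open>Diagrams of sets of parts\<close>

definition row_of :: "nat set \<Rightarrow> nat \<Rightarrow> nat" where
  "row_of S a = card {b \<in> S. a \<le> b}"

text \<open>In decreasing order a part \<open>a\<close> comes at position \<open>row_of S a\<close>,
  counted from 1 because \<open>a\<close> counts itself.\<close>

definition diagram :: "nat set \<Rightarrow> (nat \<times> nat) set" where
  "diagram S = (\<Union>a\<in>S. {row_of S a} \<times> {row_of S a + 1..row_of S a + a})"

lemma row_of_diff:
  assumes "finite S" "a \<le> b"
  shows "row_of S a = row_of S b + card (S \<inter> {a..<b})"
proof -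
  have "{c \<in> S. a \<le> c} = {c \<in> S. b \<le> c} \<union> (S \<inter> {a..<b})" using assms by auto
  moreover have "card ({c \<in> S. b \<le> c} \<union> (S \<inter> {a..<b})) = row_of S b + card (S \<inter> {a..<b})"
    unfolding row_of_def using assms by (intro card_Un_disjoint) auto
  ultimately show ?thesis by (simp add: row_of_def)
qed

lemma row_of_less:
  assumes "finite S" "a \<in> S" "a < b"
  shows "row_of S b < row_of S a"
proof -
  have "S \<inter> {a..<b} \<noteq> {}" using assms by auto
  then have "card (S \<inter> {a..<b}) > 0" using assms by (simp add: card_gt_0_iff)
  then show ?thesis using row_of_diff[of S a b] assms by simp
qed

lemma row_of_less_iff:
  assumes "finite S" "a \<in> S" "b \<in> S"
  shows "row_of S b < row_of S a \<longleftrightarrow> a < b"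
  using row_of_less[of S a b] row_of_less[of S b a] assms by (metis less_asym' linorder_neqE_nat)

lemma row_of_eq_iff:
  assumes "finite S" "a \<in> S" "b \<in> S"
  shows "row_of S a = row_of S b \<longleftrightarrow> a = b"
  using row_of_less_iff[of S a b] row_of_less_iff[of S b a] assms by (metis less_irrefl linorder_neqE_nat)

lemma finite_diagram: "finite S \<Longrightarrow> finite (diagram S)"
  by (simp add: diagram_def)

text \<open>A corner ends its row. Since each row starts one column further right, a part
  \<open>a\<close> directly below a part \<open>Suc a\<close> ends in the same column, and any
  smaller part ends earlier. So the end of the row of \<open>Suc a\<close> is a corner exactly if
  \<open>a\<close> is no part.\<close>

lemma corners_diagram:
  assumes S: "finite S" "0 \<notin> S"
  shows "corners (diagram S) = (\<lambda>a. (row_of S (Suc a), row_of S (Suc a) + Suc a)) ` {a. Suc a \<in> S \<and> a \<notin> S}"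
    (is "?L = ?R")
proof (intro set_eqI iffI)
  fix p assume p: "p \<in> ?L"
  obtain i j where ij: "p = (i, j)" by fastforce
  from p obtain b where b: "b \<in> S" "i = row_of S b" "i + 1 \<le> j" "j \<le> i + b"
    unfolding corners_def diagram_def ij by auto
  have no_row: "(i, j') \<notin> diagram S" if "j' > j" for j' using p that by (auto simp: corners_def ij)
  have no_col: "(i', j) \<notin> diagram S" if "i' > i" for i' using p that by (auto simp: corners_def ij)
  have "j = i + b"
  proof (rule ccontr)
    assume "j \<noteq> i + b"
    then have "(i, i + b) \<in> diagram S" "i + b > j" using b by (auto simp: diagram_def)
    then show False using no_row by blast
  qed
  moreover obtain a where a: "b = Suc a" using b S by (metis not0_implies_Suc)
  moreover have "a \<notin> S"
  proof
    assume aS: "a \<in> S"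
    then have "S \<inter> {a..<Suc a} = {a}" by auto
    then have r: "row_of S a = Suc i" using row_of_diff[of S a "Suc a"] S a b by simp
    moreover have "a > 0" using aS S by (metis gr0I)
    ultimately have "(Suc i, j) \<in> diagram S"
      using aS a \<open>j = i + b\<close> unfolding diagram_def by force
    then show False using no_col by blast
  qed
  ultimately show "p \<in> ?R" using b ij by auto
next
  fix p assume "p \<in> ?R"
  then obtain a where a: "Suc a \<in> S" "a \<notin> S" and p: "p = (row_of S (Suc a), row_of S (Suc a) + Suc a)" by auto
  let ?i = "row_of S (Suc a)"
  have "(?i, ?i + Suc a) \<in> diagram S" using a by (auto simp: diagram_def)
  moreover have "(?i, j) \<notin> diagram S" if "j > ?i + Suc a" for j
    using that a row_of_eq_iff[OF S(1)] unfolding diagram_def by auto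
  moreover have "(i, ?i + Suc a) \<notin> diagram S" if "i > ?i" for i
  proof
    assume "(i, ?i + Suc a) \<in> diagram S"
    then obtain c where c: "c \<in> S" "i = row_of S c" "?i + Suc a \<le> i + c" by (auto simp: diagram_def)
    then have "c < Suc a" using row_of_less_iff[OF S(1) c(1) a(1)] that by simp
    \<comment> \<open>As \<open>a\<close> is missing, at most \<open>a - c\<close> parts lie in this
      range, so the row of \<open>c\<close> ends before the column in question.\<close>
    moreover have "S \<inter> {c..<Suc a} \<subseteq> {c..<a}" using a(2) by (auto simp: less_Suc_eq)
    then have "card (S \<inter> {c..<Suc a}) \<le> card {c..<a}" by (intro card_mono) auto
    ultimately have "row_of S c + c \<le> ?i + a" using row_of_diff[of S c "Suc a"] S by simp
    then show False using c by simp
  qed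
  ultimately show "p \<in> ?L" by (auto simp: corners_def p)
qed

text \<open>Inverse of \<^const>\<open>grow\<close>: the index \<open>a\<close> is the new value of the part, and \<open>0\<close> is dropped.\<close>

definition shrink :: "nat set \<Rightarrow> nat \<Rightarrow> nat set" where
  "shrink T a = insert a (T - {Suc a}) - {0}"

text \<open>A part 0 has an empty row and comes after all positive parts. Hence
  \<open>shrink\<close> needs no separate treatment of a part that disappears.\<close>

lemma diagram_minus_0: "diagram (S - {0}) = diagram S"
proof -
  have "row_of (S - {0}) a = row_of S a" if "a \<noteq> 0" for a
  proof -
    have "{b \<in> S - {0}. a \<le> b} = {b \<in> S. a \<le> b}" using that by auto
    then show ?thesis by (simp add: row_of_def)
  qed
  then have "diagram (S - {0}) = (\<Union>a\<in>S - {0}. {row_of S a} \<times> {row_of S a + 1..row_of S a + a})"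
    unfolding diagram_def by (intro SUP_cong refl) simp
  also have "\<dots> = diagram S"
  proof -
    have "{row_of S 0} \<times> {row_of S 0 + 1..row_of S 0 + 0} = {}" by simp
    then show ?thesis unfolding diagram_def by blast
  qed
  finally show ?thesis .
qed

text \<open>As \<open>a\<close> is no part, replacing \<open>Suc a\<close> by \<open>a\<close> keeps
  the order of the parts and hence all row numbers. Only the last box of one row is lost.\<close>

lemma diagram_shrink:
  assumes T: "finite T" and a: "Suc a \<in> T" "a \<notin> T"
  shows "diagram (shrink T a) = diagram T - {(row_of T (Suc a), row_of T (Suc a) + Suc a)}"
proof -
  define R where "R = insert a (T - {Suc a})"
  have row_b: "row_of R b = row_of T b" if b: "b \<in> T" "b \<noteq> Suc a" for b
  proof (cases "b < Suc a")
    case True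
    define Q where "Q = {c \<in> T. b \<le> c} - {Suc a}"
    have "{c \<in> R. b \<le> c} = insert a Q" using True by (auto simp: R_def Q_def)
    moreover have "{c \<in> T. b \<le> c} = insert (Suc a) Q" using a True by (auto simp: Q_def)
    moreover have "finite Q" "a \<notin> Q" "Suc a \<notin> Q" using T a by (auto simp: Q_def)
    ultimately show ?thesis by (simp add: row_of_def)
  next
    case False
    then have "{c \<in> R. b \<le> c} = {c \<in> T. b \<le> c}" using b by (auto simp: R_def)
    then show ?thesis by (simp add: row_of_def)
  qed
  have row_a: "row_of R a = row_of T (Suc a)"
  proof -
    have "{c \<in> R. a \<le> c} = insert a {c \<in> T. Suc a < c}" using a by (auto simp: R_def le_eq_less_or_eq)
    moreover have "{c \<in> T. Suc a \<le> c} = insert (Suc a) {c \<in> T. Suc a < c}" using a by auto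
    ultimately show ?thesis unfolding row_of_def using T by simp
  qed
  let ?r = "row_of T (Suc a)"
  have "diagram (shrink T a) = diagram R" unfolding shrink_def R_def by (rule diagram_minus_0)
  also have "\<dots> = {?r} \<times> {?r + 1..?r + a} \<union> (\<Union>b\<in>T - {Suc a}. {row_of T b} \<times> {row_of T b + 1..row_of T b + b})"
  proof -
    have "diagram R = (\<Union>b\<in>insert a (T - {Suc a}). {row_of R b} \<times> {row_of R b + 1..row_of R b + b})"
      by (simp add: diagram_def flip: R_def)
    also have "\<dots> = {?r} \<times> {?r + 1..?r + a} \<union> (\<Union>b\<in>T - {Suc a}. {row_of R b} \<times> {row_of R b + 1..row_of R b + b})"
      by (simp add: row_a)
    also have "(\<Union>b\<in>T - {Suc a}. {row_of R b} \<times> {row_of R b + 1..row_of R b + b})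
        = (\<Union>b\<in>T - {Suc a}. {row_of T b} \<times> {row_of T b + 1..row_of T b + b})"
      by (intro SUP_cong refl) (simp add: row_b)
    finally show ?thesis .
  qed
  also have "\<dots> = diagram T - {(?r, ?r + Suc a)}"
  proof -
    have "diagram T = {?r} \<times> {?r + 1..?r + Suc a} \<union> (\<Union>b\<in>T - {Suc a}. {row_of T b} \<times> {row_of T b + 1..row_of T b + b})"
      unfolding diagram_def by (subst insert_Diff[OF a(1), symmetric]) (rule UN_insert)
    moreover have "(?r, ?r + Suc a) \<notin> (\<Union>b\<in>T - {Suc a}. {row_of T b} \<times> {row_of T b + 1..row_of T b + b})"
      by clarsimp (metis row_of_eq_iff[OF T _ a(1)])
    moreover have "{?r} \<times> {?r + 1..?r + a} = {?r} \<times> {?r + 1..?r + Suc a} - {(?r, ?r + Suc a)}" by auto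
    ultimately show ?thesis by (simp only: Un_Diff Diff_insert0 Diff_empty not_False_eq_True)
  qed
  finally show ?thesis .
qed

definition num_fillings :: "nat set \<Rightarrow> nat" where
  "num_fillings S = card (std_fillings (diagram S))"

lemma num_fillings_rec:
  assumes T: "finite T" "0 \<notin> T" "T \<noteq> {}"
  shows "num_fillings T = (\<Sum>a | Suc a \<in> T \<and> a \<notin> T. num_fillings (shrink T a))"
proof -
  obtain b where b: "b \<in> T" using T by blast
  then have "b > 0" using T by (metis gr0I)
  with b have "diagram T \<noteq> {}" by (force simp: diagram_def)
  moreover have "inj_on (\<lambda>a. (row_of T (Suc a), row_of T (Suc a) + Suc a)) {a. Suc a \<in> T \<and> a \<notin> T}"
    by (auto simp: inj_on_def)
  ultimately have "num_fillings T = (\<Sum>a | Suc a \<in> T \<and> a \<notin> T.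
      card (std_fillings (diagram T - {(row_of T (Suc a), row_of T (Suc a) + Suc a)})))"
    unfolding num_fillings_def by (subst card_std_fillings)
      (simp_all add: finite_diagram T(1) corners_diagram[OF T(1,2)] sum.reindex)
  also have "\<dots> = (\<Sum>a | Suc a \<in> T \<and> a \<notin> T. num_fillings (shrink T a))"
    by (intro sum.cong refl) (simp add: num_fillings_def diagram_shrink[OF T(1)])
  finally show ?thesis .
qed

lemma num_fillings_empty: "num_fillings {} = 1"
proof -
  have "std_fillings {} = {\<lambda>x. undefined}" by (auto simp: std_fillings_def bij_betw_def)
  then show ?thesis by (simp add: num_fillings_def diagram_def)
qed

lemma num_fillings_row: "num_fillings {Suc m} = 1"
proof (induction m)
  case 0
  have "{a. a = 0 \<and> a \<noteq> Suc 0} = {0}" by auto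
  then show ?case using num_fillings_rec[of "{Suc 0}"] num_fillings_empty by (simp add: shrink_def)
next
  case (Suc m)
  have "{a. a = Suc m \<and> a \<noteq> Suc (Suc m)} = {Suc m}" by auto
  then show ?case using num_fillings_rec[of "{Suc (Suc m)}"] Suc by (simp add: shrink_def)
qed

section \<open>From strict partitions as lists to sets of parts\<close>

lemma strict_partition_Cons:
  "strict_partition (m # lam) \<longleftrightarrow> (\<forall>x\<in>set lam. x < m) \<and> 0 < m \<and> strict_partition lam"
  by (auto simp: strict_partition_def)

lemma strict_partition_distinct: "strict_partition lam \<Longrightarrow> distinct lam"
  by (induction lam) (auto simp: strict_partition_Cons)

lemma part_nth: "i < length lam \<Longrightarrow> part lam (Suc i) = lam ! i"
  by (simp add: part_def)

lemma strict_partition_nth_less: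
  "strict_partition lam \<Longrightarrow> i < j \<Longrightarrow> j < length lam \<Longrightarrow> lam ! j < lam ! i"
  by (auto simp: strict_partition_def sorted_wrt_iff_nth_less)

lemma shifted_diagram_eq_Sigma:
  "shifted_diagram lam = (SIGMA i:{1..length lam}. {i + 1..i + part lam i})"
  by (auto simp: shifted_diagram_def)

text \<open>In a decreasing list exactly the entries at positions up to \<open>i\<close> are at
  least \<open>lam ! i\<close>, so \<open>row_of\<close> recovers the row number.\<close>

lemma shifted_diagram_eq_diagram:
  assumes "strict_partition lam"
  shows "shifted_diagram lam = diagram (set lam)"
proof -
  have row: "row_of (set lam) (lam ! i) = Suc i" if i: "i < length lam" for i
  proof -
    have "lam ! i \<le> lam ! j \<longleftrightarrow> j \<le> i" if "j < length lam" for j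
      using strict_partition_nth_less[OF assms, of i j] strict_partition_nth_less[OF assms, of j i] that i
      by (metis leD le_eq_less_or_eq linorder_not_less)
    then have "{b \<in> set lam. lam ! i \<le> b} = (!) lam ` {..i}"
      using i by (auto simp: set_conv_nth)
    moreover have "inj_on ((!) lam) {..i}"
      using i strict_partition_distinct[OF assms] by (auto simp: inj_on_def nth_eq_iff_index_eq)
    ultimately show ?thesis by (simp add: row_of_def card_image)
  qed
  have "diagram (set lam) = (\<Union>i\<in>{..<length lam}. {row_of (set lam) (lam ! i)} \<times>
      {row_of (set lam) (lam ! i) + 1..row_of (set lam) (lam ! i) + lam ! i})"
    by (auto simp: diagram_def set_conv_nth)
  also have "\<dots> = (\<Union>i\<in>{..<length lam}. {Suc i} \<times> {Suc i + 1..Suc i + part lam (Suc i)})"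
    by (auto simp: row part_nth)
  also have "\<dots> = (\<Union>i\<in>Suc ` {..<length lam}. {i} \<times> {i + 1..i + part lam i})"
    by blast
  also have "Suc ` {..<length lam} = {1..length lam}"
    by (simp add: image_Suc_lessThan)
  finally show ?thesis by (auto simp: shifted_diagram_eq_Sigma)
qed

lemma bij_betw_part:
  assumes "strict_partition lam"
  shows "bij_betw (part lam) {1..length lam} (set lam)"
proof -
  have "bij_betw ((!) lam) {..<length lam} (set lam)"
    using strict_partition_distinct[OF assms] by (intro bij_betw_nth) auto
  moreover have "bij_betw (\<lambda>i. i - 1) {1..length lam} {..<length lam}"
    by (rule bij_betw_byWitness[where f' = Suc]) auto
  ultimately have "bij_betw ((!) lam \<circ> (\<lambda>i. i - 1)) {1..length lam} (set lam)"
    using bij_betw_trans by blast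
  then show ?thesis
    by (rule bij_betw_cong[THEN iffD1, rotated]) (auto simp: part_def)
qed

text \<open>Row \<open>i\<close> starts in column \<open>i + 1\<close>, so the contents in the row
  of a part \<open>m\<close> are \<open>1, ..., m\<close>.\<close>

lemma sum_content:
  assumes "strict_partition lam"
  shows "(\<Sum>b\<in>shifted_diagram lam. \<phi> (content b)) = (\<Sum>m\<in>set lam. \<Sum>c=1..m. \<phi> (int c) :: real)"
proof -
  have "(\<Sum>b\<in>shifted_diagram lam. \<phi> (content b))
      = (\<Sum>i=1..length lam. \<Sum>j=i+1..i+part lam i. \<phi> (int j - int i))"
    unfolding shifted_diagram_eq_Sigma by (simp add: sum.Sigma content_def case_prod_beta)
  also have "\<dots> = (\<Sum>i=1..length lam. \<Sum>c=1..part lam i. \<phi> (int c))"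
  proof (rule sum.cong[OF refl])
    fix i
    show "(\<Sum>j=i+1..i+part lam i. \<phi> (int j - int i)) = (\<Sum>c=1..part lam i. \<phi> (int c))"
      by (rule sum.reindex_bij_witness[where i = "\<lambda>c. i + c" and j = "\<lambda>j. j - i"]) auto
  qed
  also have "\<dots> = (\<Sum>m\<in>set lam. \<Sum>c=1..m. \<phi> (int c))"
    by (rule sum.reindex_bij_betw[OF bij_betw_part[OF assms]])
  finally show ?thesis .
qed

lemma psize_eq_sum: "strict_partition lam \<Longrightarrow> psize lam = \<Sum>(set lam)"
  unfolding psize_def using strict_partition_distinct sum_list_distinct_conv_sum_set[of lam id] by force

lemma num_sshyt_eq:
  assumes "strict_partition lam"
  shows "num_sshyt lam = num_fillings (set lam)"
proof -
  have "card (shifted_diagram lam) = (\<Sum>i=1..length lam. part lam i)"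
    unfolding shifted_diagram_eq_Sigma by simp
  also have "\<dots> = \<Sum>(set lam)"
    by (rule sum.reindex_bij_betw[OF bij_betw_part[OF assms]])
  finally have "psize lam = card (shifted_diagram lam)" using psize_eq_sum[OF assms] by simp
  then show ?thesis
    unfolding num_sshyt_def standard_shifted_tableaux_def num_fillings_def std_fillings_def
      shifted_diagram_eq_diagram[OF assms] by simp
qed

section \<open>The product formula for hook lengths\<close>

text \<open>The product from Schur's formula for the number of standard shifted tableaux: factorials
  of the parts times a quotient for each pair of parts.\<close>

definition hook_prod_set :: "nat set \<Rightarrow> real" where
  "hook_prod_set S = (\<Prod>b\<in>S. fact b * (\<Prod>a | a \<in> S \<and> a < b. (real b + real a) / (real b - real a)))"

text \<open>The absolute value merges the pairs in which \<open>m\<close> is the larger part with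
  those in which it is the smaller one, so \<open>m\<close> may lie anywhere among the
  parts.\<close>

lemma hook_prod_set_insert:
  assumes S: "finite S" "m \<notin> S"
  shows "hook_prod_set (insert m S) = hook_prod_set S * fact m * (\<Prod>b\<in>S. (real m + real b) / \<bar>real m - real b\<bar>)"
proof -
  let ?q = "\<lambda>b a. (real b + real a) / (real b - real a)"
  have if_prod: "(\<Prod>b\<in>S. if P b then f b else 1) = (\<Prod>b | b \<in> S \<and> P b. f b)" for P and f :: "nat \<Rightarrow> real"
    using S by (simp add: prod.If_cases Collect_conj_eq)
  have other: "fact b * (\<Prod>a | a \<in> insert m S \<and> a < b. ?q b a)
      = fact b * (\<Prod>a | a \<in> S \<and> a < b. ?q b a) * (if m < b then ?q b m else 1)" if "b \<in> S" for b
  proof (cases "m < b")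
    case True
    then have "{a. a \<in> insert m S \<and> a < b} = insert m {a. a \<in> S \<and> a < b}" by auto
    then show ?thesis using S True by simp
  next
    case False
    then have "{a. a \<in> insert m S \<and> a < b} = {a. a \<in> S \<and> a < b}" by auto
    then show ?thesis using False by simp
  qed
  have self: "{a. a \<in> insert m S \<and> a < m} = {a. a \<in> S \<and> a < m}" using S by auto
  have "hook_prod_set (insert m S) = fact m * (\<Prod>a | a \<in> S \<and> a < m. ?q m a)
      * (\<Prod>b\<in>S. fact b * (\<Prod>a | a \<in> insert m S \<and> a < b. ?q b a))"
    unfolding hook_prod_set_def using S self by simp
  also have "(\<Prod>b\<in>S. fact b * (\<Prod>a | a \<in> insert m S \<and> a < b. ?q b a))
      = hook_prod_set S * (\<Prod>b\<in>S. if m < b then ?q b m else 1)"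
    unfolding hook_prod_set_def prod.distrib[symmetric] by (intro prod.cong refl other)
  also have "(\<Prod>a | a \<in> S \<and> a < m. ?q m a) = (\<Prod>b\<in>S. if b < m then ?q m b else 1)"
    using if_prod[of "\<lambda>a. a < m" "?q m"] by simp
  finally have "hook_prod_set (insert m S) = hook_prod_set S * fact m *
      ((\<Prod>b\<in>S. if b < m then ?q m b else 1) * (\<Prod>b\<in>S. if m < b then ?q b m else 1))"
    by (simp only: mult_ac)
  also have "(\<Prod>b\<in>S. if b < m then ?q m b else 1) * (\<Prod>b\<in>S. if m < b then ?q b m else 1)
      = (\<Prod>b\<in>S. (real m + real b) / \<bar>real m - real b\<bar>)"
    unfolding prod.distrib[symmetric]
  proof (rule prod.cong[OF refl])
    fix b assume "b \<in> S"
    then have "b \<noteq> m" using S by blast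
    then show "(if b < m then ?q m b else 1) * (if m < b then ?q b m else 1) = (real m + real b) / \<bar>real m - real b\<bar>"
      by (auto simp: abs_if add.commute)
  qed
  finally show ?thesis .
qed

lemma hook_prod_set_pos: "hook_prod_set S > 0"
  unfolding hook_prod_set_def
proof (intro prod_pos)
  fix b
  have "(\<Prod>a | a \<in> S \<and> a < b. (real b + real a) / (real b - real a)) > 0"
    by (intro prod_pos) (auto intro!: divide_pos_pos)
  then show "fact b * (\<Prod>a | a \<in> S \<and> a < b. (real b + real a) / (real b - real a)) > 0" by simp
qed

abbreviation shift_box :: "nat \<times> nat \<Rightarrow> nat \<times> nat" where
  "shift_box b \<equiv> (Suc (fst b), Suc (snd b))"

lemma part_Cons [simp]: "part (m # lam) (Suc 0) = m" "0 < i \<Longrightarrow> part (m # lam) (Suc i) = part lam i"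
  by (auto simp: part_def nth_Cons')

lemma shifted_diagram_Cons:
  "shifted_diagram (m # lam) = {1} \<times> {2..m + 1} \<union> shift_box ` shifted_diagram lam"
proof (intro set_eqI iffI)
  fix p assume p: "p \<in> shifted_diagram (m # lam)"
  obtain i j where ij: "p = (i, j)" by fastforce
  show "p \<in> {1} \<times> {2..m + 1} \<union> shift_box ` shifted_diagram lam"
  proof (cases "i = 1")
    case True
    then show ?thesis using p ij by (auto simp: shifted_diagram_def)
  next
    case False
    with p ij obtain i' where i': "i = Suc i'" "0 < i'" "i' \<le> length lam"
      by (cases i) (auto simp: shifted_diagram_def)
    with p ij have j: "Suc i' + 1 \<le> j" "j \<le> Suc i' + part lam i'"
      by (auto simp: shifted_diagram_def)
    then have "(i', j - 1) \<in> shifted_diagram lam" using i' by (auto simp: shifted_diagram_def)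
    moreover have "p = shift_box (i', j - 1)" using ij i' j by auto
    ultimately show ?thesis by blast
  qed
qed (auto simp: shifted_diagram_def)

lemma inj_shift_box: "inj_on shift_box A"
  by (auto simp: inj_on_def prod_eq_iff)

text \<open>A new first row moves the old diagram diagonally. Arm and leg move along, and so does
  the extra summand, because the index of every part rises by one just like the column.\<close>

lemma hook_length_shift_box:
  assumes b: "b \<in> shifted_diagram lam"
  shows "hook_length (m # lam) (shift_box b) = hook_length lam b"
proof -
  obtain i j where ij: "b = (i, j)" by fastforce
  have pos: "0 < i" "0 < j" using b ij by (auto simp: shifted_diagram_def)
  have "{(i', j'). (i', j') \<in> shifted_diagram (m # lam) \<and> i' = fst (shift_box b) \<and> j' > snd (shift_box b)}
     = shift_box ` {(i', j'). (i', j') \<in> shifted_diagram lam \<and> i' = fst b \<and> j' > snd b}"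
    unfolding shifted_diagram_Cons using pos ij by (auto simp: image_iff)
  moreover have "{(i', j'). (i', j') \<in> shifted_diagram (m # lam) \<and> j' = snd (shift_box b) \<and> i' > fst (shift_box b)}
     = shift_box ` {(i', j'). (i', j') \<in> shifted_diagram lam \<and> j' = snd b \<and> i' > fst b}"
    unfolding shifted_diagram_Cons using pos ij by (auto simp: image_iff)
  ultimately show ?thesis
    unfolding hook_length_def using pos ij by (simp add: card_image[OF inj_shift_box])
qed

text \<open>Column \<open>t\<close> of \<open>lam\<close> is the leg of the box
  \<open>(1, Suc t)\<close> once a longer row is put on top.\<close>

definition column_length :: "nat list \<Rightarrow> nat \<Rightarrow> nat" where
  "column_length lam t = card {i. (i, t) \<in> shifted_diagram lam}"

lemma hook_length_first_row:
  assumes t: "1 \<le> t" "t \<le> m"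
  shows "hook_length (m # lam) (1, Suc t) = m - t + column_length lam t + 1 + part lam t"
proof -
  have "{(i', j'). (i', j') \<in> shifted_diagram (m # lam) \<and> i' = fst (1::nat, Suc t) \<and> j' > snd (1::nat, Suc t)}
     = {1} \<times> {Suc t + 1..m + 1}"
    unfolding shifted_diagram_Cons using t by (auto simp: shifted_diagram_def)
  then have arm: "card {(i', j'). (i', j') \<in> shifted_diagram (m # lam) \<and> i' = fst (1::nat, Suc t) \<and> j' > snd (1::nat, Suc t)} = m - t"
    by simp
  have "{(i', j'). (i', j') \<in> shifted_diagram (m # lam) \<and> j' = snd (1::nat, Suc t) \<and> i' > fst (1::nat, Suc t)}
     = (\<lambda>i. (Suc i, Suc t)) ` {i. (i, t) \<in> shifted_diagram lam}"
    unfolding shifted_diagram_Cons by (auto simp: image_iff) (auto simp: shifted_diagram_def)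
  then have leg: "card {(i', j'). (i', j') \<in> shifted_diagram (m # lam) \<and> j' = snd (1::nat, Suc t) \<and> i' > fst (1::nat, Suc t)}
     = column_length lam t"
    by (simp add: column_length_def card_image inj_on_def)
  have "part (m # lam) (snd (1::nat, Suc t)) = part lam t" using t by simp
  then show ?thesis unfolding hook_length_def arm leg by simp
qed

text \<open>From one row to the next the start moves right by one, but the part drops by at least
  one, so the right ends of the rows never move right.\<close>

lemma part_plus_row_antimono:
  assumes lam: "strict_partition lam" and i: "1 \<le> i" and "i \<le> i'" "i' \<le> length lam"
  shows "i' + part lam i' \<le> i + part lam i"
  using assms(3,4)
proof (induction i' rule: dec_induct)
  case (step n)
  have "lam ! n < lam ! (n - 1)"
    using strict_partition_nth_less[OF lam, of "n - 1" n] step i by auto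
  then have "part lam (Suc n) < part lam n" using step i by (auto simp: part_def)
  then show ?case using step by simp
qed simp

lemma part_pos:
  assumes "strict_partition lam" "1 \<le> i" "i \<le> length lam"
  shows "0 < part lam i"
  using assms by (auto simp: part_def strict_partition_def)

text \<open>Row \<open>t\<close> begins only in column \<open>t + 1\<close>, while every row above
  it reaches at least as far right as row \<open>t\<close> does.\<close>

lemma column_length_le:
  assumes lam: "strict_partition lam" and t: "1 \<le> t" "t \<le> length lam"
  shows "column_length lam t = t - 1"
proof -
  have "{i. (i, t) \<in> shifted_diagram lam} = {1..<t}"
  proof (intro set_eqI iffI)
    fix i assume i: "i \<in> {1..<t}"
    then have "t + part lam t \<le> i + part lam i" using part_plus_row_antimono[OF lam, of i t] t by simp
    then show "i \<in> {i. (i, t) \<in> shifted_diagram lam}" using i t by (auto simp: shifted_diagram_def)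
  qed (auto simp: shifted_diagram_def)
  then show ?thesis by (simp add: column_length_def)
qed

lemma column_length_gt:
  assumes "length lam < t"
  shows "column_length lam t = card {i \<in> {1..length lam}. t \<le> i + part lam i}"
proof -
  have "{i. (i, t) \<in> shifted_diagram lam} = {i \<in> {1..length lam}. t \<le> i + part lam i}"
    using assms by (auto simp: shifted_diagram_def)
  then show ?thesis by (simp add: column_length_def)
qed

lemma column_length_gt_le: "length lam < t \<Longrightarrow> column_length lam t \<le> length lam"
  using card_mono[OF finite_atLeastAtMost, of "{i \<in> {1..length lam}. t \<le> i + part lam i}" 1 "length lam"]
  by (simp only: column_length_gt card_atLeastAtMost) fastforce

text \<open>The hook lengths of the first row outside the first \<open>length lam\<close> columns are the numbers
  \<open>m - v\<close>, where \<open>v\<close> runs through the non-parts below \<open>m\<close>.\<close>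

lemma bij_betw_non_parts:
  assumes lam: "strict_partition lam" and m: "\<And>x. x \<in> set lam \<Longrightarrow> x < m"
  shows "bij_betw (\<lambda>t. t - 1 - column_length lam t) {length lam + 1..m} ({..<m} - set lam)"
proof -
  let ?l = "length lam"
  let ?v = "\<lambda>t. t - 1 - column_length lam t"
  have col_le: "column_length lam t \<le> ?l" if "t > ?l" for t
    using that by (rule column_length_gt_le)
  \<comment> \<open>To the right of column \<open>?l\<close> the column lengths decrease weakly, so
    \<open>?v\<close> increases strictly.\<close>
  have "strict_mono_on {?l + 1..m} ?v"
  proof (rule strict_mono_onI)
    fix s t assume st: "s \<in> {?l + 1..m}" "t \<in> {?l + 1..m}" "s < t"
    have "column_length lam t \<le> column_length lam s"
      using st by (auto simp: column_length_gt intro!: card_mono)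
    then show "?v s < ?v t" using col_le[of s] st by auto
  qed
  then have inj: "inj_on ?v {?l + 1..m}" by (rule strict_mono_on_imp_inj_on)
  have sub: "?v ` {?l + 1..m} \<subseteq> {..<m} - set lam"
  proof clarify
    fix t assume t: "t \<in> {?l + 1..m}"
    have "?v t \<notin> set lam"
    proof
      assume "?v t \<in> set lam"
      then have "?v t \<in> part lam ` {1..?l}"
        by (simp only: bij_betw_imp_surj_on[OF bij_betw_part[OF lam]])
      then obtain i where v: "?v t = part lam i" and "i \<in> {1..?l}" by (rule imageE)
      then have i: "1 \<le> i" "i \<le> ?l" by simp_all
      note i = i v[symmetric]
      have col: "column_length lam t = card {i \<in> {1..?l}. t \<le> i + part lam i}"
        using t by (intro column_length_gt) simp
      show False
      \<comment> \<open>Here \<open>t = part lam i + column_length lam t + 1\<close>. If row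
        \<open>i\<close> reaches column \<open>t\<close>, then so do all rows above and the column
        length is at least \<open>i\<close>; otherwise it is at most \<open>i - 1\<close>. Both
        contradict the case.\<close>
      proof (cases "t \<le> i + part lam i")
        case True
        have "{1..i} \<subseteq> {i \<in> {1..?l}. t \<le> i + part lam i}"
        proof clarify
          fix k assume "k \<in> {1..i}"
          then show "k \<in> {1..?l} \<and> t \<le> k + part lam k"
            using part_plus_row_antimono[OF lam, of k i] i True by simp
        qed
        from card_mono[OF _ this] have "i \<le> column_length lam t" by (simp add: col)
        moreover have "0 < part lam i" using lam i by (intro part_pos)
        ultimately show False using True i t col_le[of t] by simp
      next
        case False
        have "{i \<in> {1..?l}. t \<le> i + part lam i} \<subseteq> {1..<i}"
        proof clarify
          fix k assume k: "k \<in> {1..?l}" "t \<le> k + part lam k"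
          then have "\<not> i \<le> k" using part_plus_row_antimono[OF lam, of i k] i False by auto
          then show "k \<in> {1..<i}" using k by simp
        qed
        from card_mono[OF _ this] have "column_length lam t \<le> i - 1" by (simp add: col)
        then show False using False i t by simp
      qed
    qed
    moreover have "?v t < m" using t by auto
    ultimately show "?v t \<in> {..<m} - set lam" by simp
  qed
  \<comment> \<open>Both sets have \<open>m - ?l\<close> elements, so the injective image fills the
    target.\<close>
  have "card (set lam) = ?l" using strict_partition_distinct[OF lam] by (rule distinct_card)
  then have "card ({..<m} - set lam) = m - ?l"
    using m by (subst card_Diff_subset) auto
  then have "?v ` {?l + 1..m} = {..<m} - set lam"
    using sub inj by (intro card_subset_eq) (simp_all add: card_image)
  then show ?thesis using inj by (simp add: bij_betw_def)
qed

text \<open>The first \<open>length lam\<close> hooks are the sums \<open>m + b\<close> over the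
  parts \<open>b\<close>; the others are the \<open>m - v\<close> over the non-parts
  \<open>v\<close>. The missing differences \<open>m - b\<close> complete the latter to
  \<open>fact m\<close>, and multiplying by them avoids division of natural numbers.\<close>

lemma first_row_hooks:
  assumes lam: "strict_partition lam" and m: "\<And>x. x \<in> set lam \<Longrightarrow> x < m"
  shows "(\<Prod>t=1..m. hook_length (m # lam) (1, Suc t)) * (\<Prod>b\<in>set lam. m - b) = fact m * (\<Prod>b\<in>set lam. m + b)"
proof -
  let ?l = "length lam"
  let ?h = "\<lambda>t. hook_length (m # lam) (1, Suc t)"
  have "card (set lam) = ?l" using strict_partition_distinct[OF lam] by (rule distinct_card)
  moreover have "set lam \<subseteq> {1..<m}" using m lam by (force simp: strict_partition_def Suc_le_eq)
  then have "card (set lam) \<le> card {1..<m}" by (intro card_mono) auto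
  ultimately have lm: "?l \<le> m" by simp
  have low: "(\<Prod>t=1..?l. ?h t) = (\<Prod>b\<in>set lam. m + b)"
  proof -
    have "(\<Prod>t=1..?l. ?h t) = (\<Prod>t=1..?l. m + part lam t)"
    proof (rule prod.cong[OF refl])
      fix t assume t: "t \<in> {1..?l}"
      then show "?h t = m + part lam t"
        using hook_length_first_row[of t m lam] column_length_le[OF lam, of t] lm by simp
    qed
    also have "\<dots> = (\<Prod>b\<in>set lam. m + b)" by (rule prod.reindex_bij_betw[OF bij_betw_part[OF lam]])
    finally show ?thesis .
  qed
  have high: "(\<Prod>t=?l+1..m. ?h t) = (\<Prod>v\<in>{..<m} - set lam. m - v)"
  proof -
    have "(\<Prod>t=?l+1..m. ?h t) = (\<Prod>t=?l+1..m. m - (t - 1 - column_length lam t))"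
    proof (rule prod.cong[OF refl])
      fix t assume t: "t \<in> {?l+1..m}"
      have "column_length lam t \<le> ?l"
        using t by (intro column_length_gt_le) simp
      moreover have "part lam t = 0" using t by (simp add: part_def)
      moreover have "?h t = m - t + column_length lam t + 1 + part lam t"
        using t by (intro hook_length_first_row) auto
      ultimately show "?h t = m - (t - 1 - column_length lam t)" using t by auto
    qed
    also have "\<dots> = (\<Prod>v\<in>{..<m} - set lam. m - v)"
      by (rule prod.reindex_bij_betw[OF bij_betw_non_parts[OF lam m]])
    finally show ?thesis .
  qed
  have "{1..m} = {1..?l} \<union> {?l+1..m}" using lm by auto
  then have "(\<Prod>t=1..m. ?h t) = (\<Prod>t=1..?l. ?h t) * (\<Prod>t=?l+1..m. ?h t)"
    by (simp only:) (intro prod.union_disjoint, auto)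
  moreover have "(\<Prod>v\<in>{..<m} - set lam. m - v) * (\<Prod>b\<in>set lam. m - b) = (\<Prod>v<m. m - v)"
    using m by (subst prod.subset_diff[of "set lam" "{..<m}"]) auto
  moreover have "(\<Prod>v<m. m - v) = fact m"
    by (simp add: fact_prod_rev atLeast0LessThan)
  ultimately show ?thesis unfolding low high by (simp add: mult.assoc mult.commute)
qed

text \<open>Induction over the rows: the first row contributes \<open>first_row_hooks\<close>, which
  is the factor in \<open>hook_prod_set_insert\<close> for a part \<open>m\<close> larger than all
  others.\<close>

lemma hook_product_eq:
  "strict_partition lam \<Longrightarrow> real (hook_product lam) = hook_prod_set (set lam)"
proof (induction lam)
  case Nil
  have "shifted_diagram [] = {}" by (auto simp: shifted_diagram_def)
  then show ?case by (simp add: hook_product_def hook_prod_set_def)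
next
  case (Cons m lam)
  then have lam: "strict_partition lam" and m: "\<And>x. x \<in> set lam \<Longrightarrow> x < m"
    by (auto simp: strict_partition_Cons)
  have fin: "finite (shifted_diagram lam)" by (simp add: shifted_diagram_eq_Sigma)
  have disj: "({1} \<times> {2..m + 1}) \<inter> shift_box ` shifted_diagram lam = {}"
    by (auto simp: shifted_diagram_def)
  have "(\<Prod>b\<in>{1} \<times> {2..m + 1}. hook_length (m # lam) b) = (\<Prod>t=1..m. hook_length (m # lam) (1, Suc t))"
    by (rule prod.reindex_bij_witness[where i = "\<lambda>t. (1, Suc t)" and j = "\<lambda>b. snd b - 1"]) auto
  moreover have "(\<Prod>b\<in>shift_box ` shifted_diagram lam. hook_length (m # lam) b) = hook_product lam"
    by (simp add: prod.reindex[OF inj_shift_box] hook_length_shift_box hook_product_def)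
  ultimately have "hook_product (m # lam) = (\<Prod>t=1..m. hook_length (m # lam) (1, Suc t)) * hook_product lam"
    unfolding hook_product_def[of "m # lam"] shifted_diagram_Cons using fin disj
    by (subst prod.union_disjoint) auto
  then have H: "real (hook_product (m # lam)) = real (\<Prod>t=1..m. hook_length (m # lam) (1, Suc t)) * hook_prod_set (set lam)"
    using Cons.IH[OF lam] by simp
  have row: "real (\<Prod>t=1..m. hook_length (m # lam) (1, Suc t)) * (\<Prod>b\<in>set lam. real m - real b)
      = fact m * (\<Prod>b\<in>set lam. real m + real b)"
  proof -
    have "real (\<Prod>b\<in>set lam. m - b) = (\<Prod>b\<in>set lam. real m - real b)"
      unfolding of_nat_prod using m by (intro prod.cong refl) (simp add: of_nat_diff less_imp_le)
    then show ?thesis using arg_cong[OF first_row_hooks[OF lam m], of real] by (simp add: of_nat_prod)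
  qed
  have "(\<Prod>b\<in>set lam. real m - real b) \<noteq> 0" using m by (auto simp: prod_zero_iff)
  then have "real (\<Prod>t=1..m. hook_length (m # lam) (1, Suc t))
      = fact m * (\<Prod>b\<in>set lam. (real m + real b) / (real m - real b))"
    using row by (simp add: prod_dividef field_simps del: of_nat_prod)
  also have "(\<Prod>b\<in>set lam. (real m + real b) / (real m - real b)) = (\<Prod>b\<in>set lam. (real m + real b) / \<bar>real m - real b\<bar>)"
    using m by (intro prod.cong refl) (simp add: less_imp_le)
  finally have "real (hook_product (m # lam)) = hook_prod_set (insert m (set lam))"
    unfolding H using m by (subst hook_prod_set_insert) (auto simp: mult_ac)
  then show ?case by simp
qed

section \<open>The Markov chain\<close>

text \<open>The number of fillings is left out: this factor changes by a multiplicative rule when a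
  box is added, whereas the number of fillings obeys an additive recursion.\<close>

definition plancherel_weight :: "nat set \<Rightarrow> real" where
  "plancherel_weight S = 2 ^ (\<Sum>S - card S) / hook_prod_set S"

lemma card_le_sum:
  assumes "0 \<notin> S" shows "card S \<le> \<Sum>S"
proof -
  have "(\<Sum>x\<in>S. 1) \<le> (\<Sum>x\<in>S. x)" using assms by (intro sum_mono) (metis Suc_leI gr0I One_nat_def)
  then show ?thesis by simp
qed

lemma sum_grow:
  assumes "finite S" "0 \<notin> S" "a \<in> insert 0 S" "Suc a \<notin> S"
  shows "\<Sum>(grow S a) = Suc (\<Sum>S)"
proof (cases "a \<in> S")
  case True
  then show ?thesis using assms sum.remove[of S a id] by (simp add: grow_def)
next
  case False
  then show ?thesis using assms by (simp add: grow_def)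
qed

text \<open>Both sides are compared part by part through \<open>hook_prod_set_insert\<close>. A new
  part 1 leaves the power of two alone, as size and length both grow; extending an old part doubles
  it.\<close>

lemma plancherel_weight_grow:
  assumes S: "finite S" "0 \<notin> S" and a: "a \<in> insert 0 S" "Suc a \<notin> S"
  shows "plancherel_weight (grow S a) = plancherel_weight S * trans_prob S a"
proof (cases "a \<in> S")
  case False
  then have a0: "a = 0" and grow: "grow S a = insert (Suc 0) S" using S a by (auto simp: grow_def)
  have "trans_prob S a = (\<Prod>b\<in>S. (up_node 0 - down_node b) / (up_node 0 - up_node b))"
  proof -
    have "insert 0 S - {0} = S" using S by auto
    then show ?thesis by (simp only: trans_prob_def prod_dividef a0)
  qed
  also have "\<dots> = (\<Prod>b\<in>S. \<bar>real (Suc 0) - real b\<bar> / (real (Suc 0) + real b))"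
  proof (rule prod.cong[OF refl])
    fix b assume "b \<in> S"
    then have b: "real b \<ge> 1" using S by (cases b) auto
    have "(1 - r) * r / 2 / ((1 + r) * (- r) / 2) = \<bar>1 - r\<bar> / (1 + r)" if "r \<ge> 1" for r :: real
    proof -
      have "\<bar>1 - r\<bar> = - (1 - r)" "r \<noteq> 0" "1 + r \<noteq> 0" using that by auto
      then show ?thesis by (simp add: diff_divide_distrib)
    qed
    from this[OF b] show "(up_node 0 - down_node b) / (up_node 0 - up_node b) = \<bar>real (Suc 0) - real b\<bar> / (real (Suc 0) + real b)"
      unfolding up_minus_down up_minus_up by simp
  qed
  finally have t: "trans_prob S a = 1 / (\<Prod>b\<in>S. (real (Suc 0) + real b) / \<bar>real (Suc 0) - real b\<bar>)"
    by (simp add: prod_dividef)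
  have "hook_prod_set (grow S a) = hook_prod_set S * (\<Prod>b\<in>S. (real (Suc 0) + real b) / \<bar>real (Suc 0) - real b\<bar>)"
    unfolding grow using hook_prod_set_insert[of S "Suc 0"] S a a0 by simp
  moreover have "\<Sum>(grow S a) - card (grow S a) = \<Sum>S - card S"
    using sum_grow[OF S a] grow S a a0 by simp
  ultimately show ?thesis unfolding plancherel_weight_def t by simp
next
  case True
  define R where "R = S - {a}"
  have R: "finite R" "a \<notin> R" "Suc a \<notin> R" "0 \<notin> R" using S a by (auto simp: R_def)
  have a_pos: "a > 0" using True S by (metis gr0I)
  have S_eq: "S = insert a R" and grow: "grow S a = insert (Suc a) R" using True by (auto simp: R_def grow_def)
  define P1 where "P1 = (\<Prod>b\<in>R. (real a + real b) / \<bar>real a - real b\<bar>)"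
  define P2 where "P2 = (\<Prod>b\<in>R. (real (Suc a) + real b) / \<bar>real (Suc a) - real b\<bar>)"
  have pos: "P1 > 0" "P2 > 0" "hook_prod_set R > 0"
  proof -
    have "real m + real b > 0" "\<bar>real m - real b\<bar> > 0" if "b \<in> R" "m > 0" "m \<notin> R" for b m
      using that by auto
    then show "P1 > 0" "P2 > 0" unfolding P1_def P2_def
      using R a_pos by (auto intro!: prod_pos divide_pos_pos simp del: of_nat_Suc)
  qed (rule hook_prod_set_pos)
  have "insert 0 S - {a} = insert 0 R" using a_pos by (auto simp: R_def)
  then have "trans_prob S a = (up_node a - down_node a) / up_node a
      * (\<Prod>b\<in>R. (up_node a - down_node b) / (up_node a - up_node b))"
    unfolding trans_prob_def using R by (simp add: S_eq prod_dividef)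
  also have "(\<Prod>b\<in>R. (up_node a - down_node b) / (up_node a - up_node b))
      = (\<Prod>b\<in>R. ((real a + real b) / \<bar>real a - real b\<bar>) / ((real (Suc a) + real b) / \<bar>real (Suc a) - real b\<bar>))"
  proof (rule prod.cong[OF refl])
    fix b assume "b \<in> R"
    \<comment> \<open>So \<open>a - b\<close> and \<open>a + 1 - b\<close> have the same sign, and
      the signs from the two absolute values cancel.\<close>
    then have "b < a \<or> Suc a < b" using R by (metis linorder_neqE_nat not_less_eq)
    then show "(up_node a - down_node b) / (up_node a - up_node b)
      = ((real a + real b) / \<bar>real a - real b\<bar>) / ((real (Suc a) + real b) / \<bar>real (Suc a) - real b\<bar>)"
      unfolding up_minus_down up_minus_up
    proof
      assume "b < a"
      then have "\<bar>real a - real b\<bar> = real a - real b" "\<bar>real (Suc a) - real b\<bar> = real a + 1 - real b" by auto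
      then show "(real a + 1 - real b) * (real a + real b) / 2 / ((real a + 1 + real b) * (real a - real b) / 2)
        = (real a + real b) / \<bar>real a - real b\<bar> / ((real (Suc a) + real b) / \<bar>real (Suc a) - real b\<bar>)"
        by (simp add: mult_ac add_ac)
    next
      assume "Suc a < b"
      then have "\<bar>real a - real b\<bar> = - (real a - real b)" "\<bar>real (Suc a) - real b\<bar> = - (real a + 1 - real b)" by auto
      then show "(real a + 1 - real b) * (real a + real b) / 2 / ((real a + 1 + real b) * (real a - real b) / 2)
        = (real a + real b) / \<bar>real a - real b\<bar> / ((real (Suc a) + real b) / \<bar>real (Suc a) - real b\<bar>)"
        by (simp only: divide_minus_right minus_divide_left[symmetric] minus_divide_divide) (simp add: mult_ac add_ac)
    qed
  qed
  also have "\<dots> = P1 / P2" unfolding P1_def P2_def by (rule prod_dividef)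
  \<comment> \<open>The factor left over from \<open>b = a\<close> above and the node 0 below: the 2
    matches the doubled power of two, \<open>Suc a\<close> the growth of the factorial.\<close>
  also have "(up_node a - down_node a) / up_node a = 2 / real (Suc a)"
  proof -
    have "up_node a - down_node a = real a" by (simp add: up_node_def down_node_def field_simps)
    then show ?thesis using a_pos by (simp add: up_node_def)
  qed
  finally have t: "trans_prob S a = 2 / real (Suc a) * (P1 / P2)" .
  have hS: "hook_prod_set S = hook_prod_set R * fact a * P1"
    unfolding S_eq P1_def using R by (intro hook_prod_set_insert)
  have hG: "hook_prod_set (grow S a) = hook_prod_set R * fact (Suc a) * P2"
    unfolding grow P2_def using R by (intro hook_prod_set_insert)
  have "card (grow S a) = Suc (card R)" unfolding grow using R by simp
  moreover have "card S = Suc (card R)" unfolding S_eq using R by simp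
  ultimately have e: "\<Sum>(grow S a) - card (grow S a) = Suc (\<Sum>S - card S)"
    using sum_grow[OF S a] card_le_sum[OF S(2)] by simp
  show ?thesis
    unfolding plancherel_weight_def hS hG t e using pos by (simp add: field_simps del: of_nat_Suc)
qed

text \<open>A blocked move has a vanishing factor, because
  \<open>up_node a = down_node (Suc a)\<close>. This lets sums run over all of
  \<open>insert 0 S\<close>.\<close>

lemma trans_prob_eq_0:
  assumes "finite S" "Suc a \<in> S" shows "trans_prob S a = 0"
  using assms by (auto simp: trans_prob_def down_node_Suc intro!: prod_zero bexI[of _ "Suc a"])

definition strict_parts :: "nat \<Rightarrow> nat set set" where
  "strict_parts n = {S. finite S \<and> 0 \<notin> S \<and> \<Sum>S = n}"

lemma finite_strict_parts: "finite (strict_parts n)"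
proof (rule finite_subset)
  show "strict_parts n \<subseteq> Pow {..n}"
  proof (intro subsetI PowI)
    fix S x assume "S \<in> strict_parts n" "x \<in> S"
    then show "x \<in> {..n}" using member_le_sum[of x S id] by (simp add: strict_parts_def)
  qed
qed simp

definition expect :: "nat \<Rightarrow> (nat set \<Rightarrow> real) \<Rightarrow> real" where
  "expect n g = (\<Sum>S\<in>strict_parts n. plancherel_weight S * real (num_fillings S) * g S)"

lemma expect_cong: "(\<And>S. finite S \<Longrightarrow> 0 \<notin> S \<Longrightarrow> f S = g S) \<Longrightarrow> expect n f = expect n g"
  unfolding expect_def by (intro sum.cong refl) (simp add: strict_parts_def)

lemma expect_linear: "expect n (\<lambda>S. c * f S + g S) = c * expect n f + expect n g"
  unfolding expect_def by (simp add: algebra_simps sum.distrib sum_distrib_left)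

lemma expect_diff: "expect n (\<lambda>S. f S - g S) = expect n f - expect n g"
  unfolding expect_def by (simp add: algebra_simps sum_subtractf)

text \<open>After \<open>num_fillings_rec\<close> the sum runs over pairs of a set and a removable
  box. Matching these with pairs of a smaller set and an addable box, the weight splits off
  \<open>trans_prob\<close>.\<close>

lemma expect_Suc:
  "expect (Suc n) g = expect n (\<lambda>S. \<Sum>a\<in>insert 0 S. trans_prob S a * g (grow S a))"
proof -
  let ?w = "\<lambda>T a. plancherel_weight T * real (num_fillings (shrink T a)) * g T"
  have fin: "finite {a. Suc a \<in> T \<and> a \<notin> T}" if "finite T" for T
  proof (rule finite_subset)
    show "{a. Suc a \<in> T \<and> a \<notin> T} \<subseteq> (\<lambda>b. b - 1) ` T" by force
  qed (use that in simp)
  have "expect (Suc n) g = (\<Sum>T\<in>strict_parts (Suc n). \<Sum>a | Suc a \<in> T \<and> a \<notin> T. ?w T a)"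
    unfolding expect_def
  proof (rule sum.cong[OF refl])
    fix T assume "T \<in> strict_parts (Suc n)"
    then have "finite T" "0 \<notin> T" "T \<noteq> {}" by (auto simp: strict_parts_def)
    from num_fillings_rec[OF this]
    show "plancherel_weight T * real (num_fillings T) * g T = (\<Sum>a | Suc a \<in> T \<and> a \<notin> T. ?w T a)"
      by (simp add: sum_distrib_left sum_distrib_right)
  qed
  also have "\<dots> = (\<Sum>(T, a)\<in>(SIGMA T:strict_parts (Suc n). {a. Suc a \<in> T \<and> a \<notin> T}). ?w T a)"
    using finite_strict_parts fin by (subst sum.Sigma) (auto simp: strict_parts_def)
  also have "\<dots> = (\<Sum>(S, a)\<in>(SIGMA S:strict_parts n. {a \<in> insert 0 S. Suc a \<notin> S}).
      plancherel_weight S * real (num_fillings S) * (trans_prob S a * g (grow S a)))"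
  proof (rule sum.reindex_bij_witness[where i = "\<lambda>(S, a). (grow S a, a)" and j = "\<lambda>(T, a). (shrink T a, a)"])
    fix p assume "p \<in> (SIGMA T:strict_parts (Suc n). {a. Suc a \<in> T \<and> a \<notin> T})"
    then obtain T a where p: "p = (T, a)" and T: "finite T" "0 \<notin> T" "\<Sum>T = Suc n" "Suc a \<in> T" "a \<notin> T"
      by (auto simp: strict_parts_def)
    have inv: "grow (shrink T a) a = T" using T by (auto simp: grow_def shrink_def)
    have S: "finite (shrink T a)" "0 \<notin> shrink T a" "a \<in> insert 0 (shrink T a)" "Suc a \<notin> shrink T a"
      using T by (auto simp: shrink_def)
    have "\<Sum>(shrink T a) = n" using sum_grow[OF S] T unfolding inv by simp
    then show "(case p of (T, a) \<Rightarrow> (shrink T a, a)) \<in> (SIGMA S:strict_parts n. {a \<in> insert 0 S. Suc a \<notin> S})"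
      using S by (simp add: strict_parts_def p)
    show "(case case p of (T, a) \<Rightarrow> (shrink T a, a) of (S, a) \<Rightarrow> (grow S a, a)) = p"
      by (simp add: p inv)
    show "(case case p of (T, a) \<Rightarrow> (shrink T a, a) of (S, a) \<Rightarrow>
        plancherel_weight S * real (num_fillings S) * (trans_prob S a * g (grow S a))) = (case p of (T, a) \<Rightarrow> ?w T a)"
      using plancherel_weight_grow[OF S] by (simp add: p inv)
  next
    fix p assume "p \<in> (SIGMA S:strict_parts n. {a \<in> insert 0 S. Suc a \<notin> S})"
    then obtain S a where p: "p = (S, a)" and S: "finite S" "0 \<notin> S" "a \<in> insert 0 S" "Suc a \<notin> S" and sum: "\<Sum>S = n"
      by (auto simp: strict_parts_def)
    have "shrink (grow S a) a = S" using S by (auto simp: grow_def shrink_def)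
    then show "(case case p of (S, a) \<Rightarrow> (grow S a, a) of (T, a) \<Rightarrow> (shrink T a, a)) = p"
      by (simp add: p)
    have "finite (grow S a)" "0 \<notin> grow S a" "Suc a \<in> grow S a" "a \<notin> grow S a"
      using S by (auto simp: grow_def)
    then show "(case p of (S, a) \<Rightarrow> (grow S a, a)) \<in> (SIGMA T:strict_parts (Suc n). {a. Suc a \<in> T \<and> a \<notin> T})"
      using sum_grow[OF S] sum by (simp add: p strict_parts_def)
  qed
  also have "\<dots> = (\<Sum>S\<in>strict_parts n. \<Sum>a | a \<in> insert 0 S \<and> Suc a \<notin> S.
      plancherel_weight S * real (num_fillings S) * (trans_prob S a * g (grow S a)))"
    using finite_strict_parts by (subst sum.Sigma) (auto simp: strict_parts_def)
  \<comment> \<open>The blocked moves are put back with probability 0.\<close>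
  also have "\<dots> = expect n (\<lambda>S. \<Sum>a\<in>insert 0 S. trans_prob S a * g (grow S a))"
    unfolding expect_def sum_distrib_left
    by (intro sum.cong refl sum.mono_neutral_left) (auto simp: strict_parts_def trans_prob_eq_0)
  finally show ?thesis .
qed

text \<open>As the transition probabilities sum to 1, \<open>f S\<close> can be moved inside the
  average over \<open>a\<close>.\<close>

lemma expect_increment:
  assumes "\<And>S a. addable S a \<Longrightarrow> f (grow S a) - f S = g S (up_node a)"
  shows "expect (Suc n) f - expect n f = expect n (\<lambda>S. \<Sum>a\<in>insert 0 S. trans_prob S a * g S (up_node a))"
  unfolding expect_Suc expect_diff[symmetric]
proof (rule expect_cong)
  fix S :: "nat set" assume S: "finite S" "0 \<notin> S"
  have "f S = (\<Sum>a\<in>insert 0 S. trans_prob S a * f S)"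
    using moment_0[OF S] by (simp add: moment_def flip: sum_distrib_right)
  then have "(\<Sum>a\<in>insert 0 S. trans_prob S a * f (grow S a)) - f S
      = (\<Sum>a\<in>insert 0 S. trans_prob S a * (f (grow S a) - f S))"
    by (simp only: right_diff_distrib sum_subtractf)
  also have "\<dots> = (\<Sum>a\<in>insert 0 S. trans_prob S a * g S (up_node a))"
    using S assms[of S] by (intro sum.cong refl) (metis addable_def mult_eq_0_iff trans_prob_eq_0)
  finally show "(\<Sum>a\<in>insert 0 S. trans_prob S a * f (grow S a)) - f S
      = (\<Sum>a\<in>insert 0 S. trans_prob S a * g S (up_node a))" .
qed

text \<open>Averaging \<open>x ^ j\<close> over \<open>a\<close> gives \<open>moment S j\<close>, so
  a monomial becomes a product of moments of the same weight. Its one-step difference has smaller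
  weight and falls under the induction on \<open>d\<close>; summation then restores one
  degree.\<close>

lemma binomial_comb_expect:
  assumes "g \<in> weight_below d"
  shows "binomial_comb d (\<lambda>n. expect n (\<lambda>S. \<Sum>a\<in>insert 0 S. trans_prob S a * g S (up_node a)))"
  using assms
proof (induction d arbitrary: g rule: less_induct)
  case (less d)
  show ?case using less.prems
  proof induction
    case zero
    then show ?case by (simp add: expect_def binomial_comb_zero)
  next
    case (add_monomial g rs j c)
    let ?rs = "j # rs"
    obtain u where u: "u \<in> weight_below (sum_list ?rs)"
      "\<And>S a. addable S a \<Longrightarrow> moments ?rs (grow S a) - moments ?rs S = u S (up_node a)"
      using moments_increment by blast
    have d: "sum_list ?rs < d" using add_monomial by simp
    have inc: "expect (Suc n) (moments ?rs) - expect n (moments ?rs)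
        = expect n (\<lambda>S. \<Sum>a\<in>insert 0 S. trans_prob S a * u S (up_node a))" for n
      by (rule expect_increment) (rule u(2))
    have "binomial_comb (Suc (sum_list ?rs)) (\<lambda>n. expect n (moments ?rs))"
      by (rule binomial_comb_sum) (simp only: inc less.IH[OF d u(1)])
    then have "binomial_comb d (\<lambda>n. expect n (moments ?rs))"
      by (rule binomial_comb_mono) (use d in simp)
    from binomial_comb_scale_add[OF this add_monomial.IH, of c]
    show ?case unfolding expect_linear[symmetric]
      by (simp add: moment_def sum_distrib_left sum_distrib_right sum.distrib distrib_left mult_ac)
  qed
qed

section \<open>The expected content sum\<close>

definition content_sum :: "nat \<Rightarrow> nat set \<Rightarrow> real" where
  "content_sum k S = (\<Sum>m\<in>S. \<Sum>c=1..m. (real c + real k - 1) gchoose (2 * k))"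

text \<open>The one new box has content \<open>a + 1\<close>, and
  \<open>(a + 1) + k - 1 = a + k\<close>.\<close>

lemma content_sum_grow:
  assumes "addable S a"
  shows "content_sum k (grow S a) - content_sum k S = (real a + real k) gchoose (2 * k)"
proof -
  have S: "finite S" "0 \<notin> S" "a \<in> insert 0 S" "Suc a \<notin> S" using assms by (auto simp: addable_def)
  let ?f = "\<lambda>m. \<Sum>c=1..m. (real c + real k - 1) gchoose (2 * k)"
  have "content_sum k S = ?f a + sum ?f (S - {a})"
  proof (cases "a \<in> S")
    case True
    then show ?thesis using S by (simp add: content_sum_def sum.remove)
  next
    case False
    then show ?thesis using S by (simp add: content_sum_def)
  qed
  moreover have "content_sum k (grow S a) = ?f (Suc a) + sum ?f (S - {a})"
    using S by (simp add: content_sum_def grow_def)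
  ultimately show ?thesis by (simp add: add_ac)
qed

text \<open>With \<open>x = a (a + 1) / 2\<close> one has \<open>(a + k + 1) (a - k) = 2 x - k (k + 1)\<close>, so that the binomial
  coefficient is a polynomial of degree \<open>k\<close> in \<open>x\<close>.\<close>

lemma gbinomial_weight_below:
  "\<exists>g\<in>weight_below (Suc k). \<forall>S a. g S (up_node a) = (real a + real k) gchoose (2 * k)"
proof (induction k)
  case 0
  have "(\<lambda>S x. 1 * moments [] S * x ^ 0) \<in> weight_below (Suc 0)"
    by (intro weight_below_monomial) simp
  then show ?case by (intro bexI) auto
next
  case (Suc k)
  then obtain g where g: "g \<in> weight_below (Suc k)"
    "\<And>S a. g S (up_node a) = (real a + real k) gchoose (2 * k)" by blast
  \<comment> \<open>The quotient of \<open>fact (2 * k + 2)\<close> by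
    \<open>fact (2 * k)\<close>.\<close>
  define C where "C = (2 * real k + 1) * (2 * real k + 2)"
  let ?G = "\<lambda>S x. (2 / C) * moments [] S * x ^ 1 * g S x + (- (real k * (real k + 1)) / C) * moments [] S * x ^ 0 * g S x"
  have "?G \<in> weight_below (Suc (Suc k))"
    using weight_below_mult_monomial[OF g(1), of "[]" 1 1 "2 / C"]
      weight_below_mult_monomial[OF g(1), of "[]" 0 1 "- (real k * (real k + 1)) / C"]
    by (intro weight_below_add) simp_all
  moreover have "?G S (up_node a) = (real a + real (Suc k)) gchoose (2 * Suc k)" for S a
  proof -
    let ?z = "real a + real k"
    have "real (Suc (2 * k)) * (?z gchoose Suc (2 * k)) = (?z - 2 * real k) * (?z gchoose (2 * k))"
      using gbinomial_mult_1[of ?z "2 * k"] by (simp add: algebra_simps)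
    then have 1: "?z gchoose Suc (2 * k) = (?z - 2 * real k) * (?z gchoose (2 * k)) / (2 * real k + 1)"
      by (simp add: field_simps)
    have 2: "(?z + 1) gchoose Suc (Suc (2 * k)) = (?z + 1) / (2 * real k + 2) * (?z gchoose Suc (2 * k))"
      using gbinomial_factors[of ?z "Suc (2 * k)"] by (simp add: add_ac)
    have "(?z + 1) gchoose Suc (Suc (2 * k)) = (?z + 1) * (?z - 2 * real k) / C * (?z gchoose (2 * k))"
      unfolding 2 1 C_def by (simp only: times_divide_eq_left times_divide_eq_right divide_divide_eq_left mult_ac)
    also have "(?z + 1) * (?z - 2 * real k) = 2 * up_node a - real k * (real k + 1)"
      by (simp add: up_node_def field_simps)
    finally show ?thesis by (simp add: g(2) add_ac left_diff_distrib diff_divide_distrib)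
  qed
  ultimately show ?case by (intro bexI[of _ ?G]) auto
qed

text \<open>Contents \<open>c\<close> from 1 to \<open>k\<close> give upper entries
  \<open>c + k - 1\<close>, which are natural numbers below \<open>2 * k\<close>.\<close>

lemma content_sum_eq_0:
  assumes "\<And>m. m \<in> S \<Longrightarrow> m \<le> k"
  shows "content_sum k S = 0"
  unfolding content_sum_def
proof (intro sum.neutral ballI)
  fix m c assume "m \<in> S" "c \<in> {1..m}"
  then have c: "1 \<le> c" "c \<le> k" using assms by force+
  then have "real c + real k - 1 = real (c + k - 1)" by (simp add: of_nat_diff)
  then have "(real c + real k - 1) gchoose (2 * k) = real ((c + k - 1) choose (2 * k))"
    by (simp only: binomial_gbinomial)
  also have "\<dots> = 0" using c by simp
  finally show "(real c + real k - 1) gchoose (2 * k) = 0" .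
qed

text \<open>Only the last box counts: its content \<open>k + 1\<close> gives
  \<open>2 * k choose 2 * k\<close>.\<close>

lemma content_sum_row: "content_sum k {Suc k} = 1"
proof -
  have "content_sum k {Suc k} = content_sum k {k} + ((real (Suc k) + real k - 1) gchoose (2 * k))"
    by (simp add: content_sum_def)
  also have "real (Suc k) + real k - 1 = real (2 * k)" by simp
  also have "real (2 * k) gchoose (2 * k) = 1"
    by (simp only: binomial_gbinomial[symmetric] binomial_n_n of_nat_1)
  finally show ?thesis using content_sum_eq_0[of "{k}" k] by simp
qed

lemma expect_content_sum:
  "expect n (content_sum k) = 2 ^ k / fact (k + 1) * real (n choose (k + 1))"
proof -
  obtain g where g: "g \<in> weight_below (Suc k)"
    "\<And>S a. g S (up_node a) = (real a + real k) gchoose (2 * k)"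
    using gbinomial_weight_below by blast
  have inc: "expect (Suc n) (content_sum k) - expect n (content_sum k)
      = expect n (\<lambda>S. \<Sum>a\<in>insert 0 S. trans_prob S a * g S (up_node a))" for n
    by (rule expect_increment) (simp add: content_sum_grow g(2))
  have comb: "binomial_comb (Suc (Suc k)) (\<lambda>n. expect n (content_sum k))"
    by (rule binomial_comb_sum) (simp only: inc binomial_comb_expect[OF g(1)])
  have part_le: "m \<le> n" if "S \<in> strict_parts n" "m \<in> S" for S m n
    using that member_le_sum[of m S id] by (simp add: strict_parts_def)
  have "expect n (content_sum k) = 0" if "n < Suc k" for n
    unfolding expect_def
  proof (intro sum.neutral ballI)
    fix S assume "S \<in> strict_parts n"
    then have "content_sum k S = 0" using part_le that by (intro content_sum_eq_0) force
    then show "plancherel_weight S * real (num_fillings S) * content_sum k S = 0" by simp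
  qed
  then have "expect n (content_sum k) = expect (Suc k) (content_sum k) * real (n choose Suc k)"
    by (rule binomial_comb_eq_top[OF comb])
  also have "expect (Suc k) (content_sum k) = plancherel_weight {Suc k} * real (num_fillings {Suc k}) * content_sum k {Suc k}"
  proof -
    have row: "{Suc k} \<in> strict_parts (Suc k)" by (simp add: strict_parts_def)
    have "content_sum k S = 0" if S: "S \<in> strict_parts (Suc k)" "S \<noteq> {Suc k}" for S
    proof (rule content_sum_eq_0)
      fix m assume m: "m \<in> S"
      have "m \<noteq> Suc k"
      proof
        assume mk: "m = Suc k"
        have "Suc k + \<Sum>(S - {m}) = Suc k"
          using S m sum.remove[of S m id] by (simp add: strict_parts_def mk)
        then have "\<forall>x\<in>S - {m}. x = 0" using S by (simp add: strict_parts_def)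
        moreover have "0 \<notin> S" using S by (simp add: strict_parts_def)
        ultimately have "S - {m} = {}" by (metis DiffD1 ex_in_conv)
        then have "S = {m}" using m by blast
        then show False using S mk by blast
      qed
      then show "m \<le> k" using part_le[OF S(1) m] by simp
    qed
    then show ?thesis unfolding expect_def using row finite_strict_parts
      by (subst sum.remove[of _ "{Suc k}"]) (auto intro!: sum.neutral)
  qed
  \<comment> \<open>For a single part \<open>Suc k\<close> the exponent of 2 is
    \<open>Suc k - 1\<close>, the hook product is a factorial, and there is one filling.\<close>
  also have "\<dots> = 2 ^ k / fact (Suc k)"
  proof -
    have "hook_prod_set {Suc k} = fact (Suc k)"
      using hook_prod_set_insert[of "{}" "Suc k"] by (simp add: hook_prod_set_def)
    then show ?thesis by (simp add: plancherel_weight_def num_fillings_row content_sum_row)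
  qed
  finally show ?thesis by simp
qed

section \<open>Return to sums over strict partitions\<close>

lemma bij_betw_strict_partitions:
  "bij_betw set {lam. strict_partition lam \<and> psize lam = n} (strict_parts n)"
proof (rule bij_betw_byWitness[where f' = "\<lambda>S. rev (sorted_list_of_set S)"])
  show "\<forall>lam\<in>{lam. strict_partition lam \<and> psize lam = n}. rev (sorted_list_of_set (set lam)) = lam"
  proof clarify
    fix lam assume lam: "strict_partition lam"
    then have "sorted_wrt (<) (rev lam)" by (simp add: strict_partition_def sorted_wrt_rev)
    then have "sorted_list_of_set (set (rev lam)) = rev lam"
      by (intro sorted_list_of_set.idem_if_sorted_distinct) (auto simp: strict_sorted_iff)
    then show "rev (sorted_list_of_set (set lam)) = lam" by simp
  qed
  have sp: "strict_partition (rev (sorted_list_of_set S))" if "S \<in> strict_parts n" for S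
  proof -
    have "finite S" "\<forall>x\<in>S. 0 < x" using that by (auto simp: strict_parts_def) (metis gr0I)
    then show ?thesis by (simp add: strict_partition_def sorted_wrt_rev)
  qed
  show "\<forall>S\<in>strict_parts n. set (rev (sorted_list_of_set S)) = S"
    by (auto simp: strict_parts_def)
  show "(\<lambda>S. rev (sorted_list_of_set S)) ` strict_parts n \<subseteq> {lam. strict_partition lam \<and> psize lam = n}"
  proof clarify
    fix S assume S: "S \<in> strict_parts n"
    then show "strict_partition (rev (sorted_list_of_set S)) \<and> psize (rev (sorted_list_of_set S)) = n"
      using sp[OF S] psize_eq_sum[OF sp[OF S]] by (simp add: strict_parts_def)
  qed
  show "set ` {lam. strict_partition lam \<and> psize lam = n} \<subseteq> strict_parts n"
    by (auto simp: psize_eq_sum strict_parts_def strict_partition_def)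
qed

theorem theorem1p2:
  fixes k n :: nat
  shows "(\<Sum>lam\<in>{lam. strict_partition lam \<and> psize lam = n}.
            (2::real) ^ (psize lam - plength lam) * real (num_sshyt lam) / real (hook_product lam)
            * (\<Sum>b\<in>shifted_diagram lam. (real_of_int (content b) + real k - 1) gchoose (2 * k)))
         = 2 ^ k / fact (k + 1) * real (n choose (k + 1))"
proof -
  let ?t = "\<lambda>S. plancherel_weight S * real (num_fillings S) * content_sum k S"
  have "(2::real) ^ (psize lam - plength lam) * real (num_sshyt lam) / real (hook_product lam)
            * (\<Sum>b\<in>shifted_diagram lam. (real_of_int (content b) + real k - 1) gchoose (2 * k)) = ?t (set lam)"
    if lam: "strict_partition lam" for lam
  proof -
    have "plength lam = card (set lam)"
      using strict_partition_distinct[OF lam] by (simp add: plength_def distinct_card)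
    moreover have "(\<Sum>b\<in>shifted_diagram lam. (real_of_int (content b) + real k - 1) gchoose (2 * k)) = content_sum k (set lam)"
      using sum_content[OF lam, of "\<lambda>c. (real_of_int c + real k - 1) gchoose (2 * k)"] by (simp add: content_sum_def)
    ultimately show ?thesis
      by (simp add: plancherel_weight_def psize_eq_sum[OF lam] num_sshyt_eq[OF lam] hook_product_eq[OF lam])
  qed
  then have "(\<Sum>lam\<in>{lam. strict_partition lam \<and> psize lam = n}.
            (2::real) ^ (psize lam - plength lam) * real (num_sshyt lam) / real (hook_product lam)
            * (\<Sum>b\<in>shifted_diagram lam. (real_of_int (content b) + real k - 1) gchoose (2 * k)))
      = (\<Sum>lam\<in>{lam. strict_partition lam \<and> psize lam = n}. ?t (set lam))"
    by (intro sum.cong) auto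
  also have "\<dots> = expect n (content_sum k)"
    unfolding expect_def by (rule sum.reindex_bij_betw[OF bij_betw_strict_partitions])
  finally show ?thesis by (simp only: expect_content_sum)
qed

end
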